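(* Let the control policy be $\mu^*$ given by $u_k^*=-K_k\hat x_k$. Define the queuing policy $\pi'$ by $$\eta_k^+=\operatorname*{arg\,min}_{\eta_k\in\{0,\dots,\eta_{k-1}+1\}}\Big\{-\theta_k\eta_k+\Big(\sum_{t=1}^{\eta_k}A^{t-1}w_{k-t}\Big)^T\Gamma_k\Big(\sum_{t=1}^{\eta_k}A^{t-1}w_{k-t}\Big)\Big\},$$ where $\Gamma_k=K_k^T(B^TS_{k+1}B+R_k)K_k$, and let $\pi''$ be the zero-wait queuing policy $\eta_k=0$ for all $k$. Then $\chi(\pi',\mu^* )\le\chi(\pi'',\mu^* )$.
   Context: Let $A\in\mathbb{R}^{n\times n}$, $B\in\mathbb{R}^{n\times m}$ with $(A,B)$ controllable. The plant evolves as $x_{k+1}=Ax_k+Bu_k+w_k$, $k=0,\dots,N$, where $x_0$ is Gaussian with mean $m_0$ and covariance $M_0$, the $w_k\in\mathbb{R}^n$ are independent zero-mean Gaussian vectors with covariance $W_k\succ0$, independent of $x_0$. The age of information is an integer sequence $\eta_0=0$, $\eta_k\in\{0,1,\dots,\eta_{k-1}+1\}$; at time $k$ the latest measurement at the controller is $x_{k-\eta_k}$, and the controller estimate is $\hat x_k=A^{\eta_k}x_{k-\eta_k}+\sum_{t=1}^{\eta_k}A^{t-1}Bu_{k-t}$. Queuing information set: $\mathcal{I}^q_k=\{w_t: t\le k-1\}$; a queuing policy $\pi=\{\eta_0,\dots,\eta_N\}$ is admissible if $\eta_k$ is $\mathcal{I}^q_k$-measurable. Weights: $Q_k\succeq0$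 ($k=0,\dots,N+1$), $R_k\succ0$, real $\theta_k$. Cost: $$\chi(\pi,\mu)=\mathbb{E}\Big[x_{N+1}^TQ_{N+1}x_{N+1}+\sum_{k=0}^N\big(-\theta_k\eta_k+x_k^TQ_kx_k+u_k^TR_ku_k\big)\Big].$$ Riccati recursion: $S_{N+1}=Q_{N+1}$, $K_k=(R_k+B^TS_{k+1}B)^{-1}B^TS_{k+1}A$, $S_k=Q_k+A^TS_{k+1}A-K_k^T(R_k+B^TS_{k+1}B)K_k$ for $k=N,\dots,0$. *)

theory Defs
  imports "HOL-Probability.Probability"
begin

type_synonym ('r,'c) mat = "real ^ 'c ^ 'r"

(* matrix power A^k *)
primrec mpow :: "real^'n^'n \<Rightarrow> nat \<Rightarrow> real^'n^'n" where
  "mpow A 0 = mat 1"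
| "mpow A (Suc k) = A ** mpow A k"

(* (A,B) controllable: Kalman rank condition, i.e. the columns of
   [B, AB, ..., A^(n-1)B] span R^n *)
definition controllable :: "real^'n^'n \<Rightarrow> real^'m^'n \<Rightarrow> bool" where
  "controllable A B \<longleftrightarrow>
     span {mpow A i *v (B *v u) | i u. i < CARD('n)} = (UNIV :: (real^'n) set)"

definition psd :: "real^'n^'n \<Rightarrow> bool" where
  "psd P \<longleftrightarrow> transpose P = P \<and> (\<forall>v. 0 \<le> v \<bullet> (P *v v))"

definition pd :: "real^'n^'n \<Rightarrow> bool" where
  "pd P \<longleftrightarrow> transpose P = P \<and> (\<forall>v. v \<noteq> 0 \<longrightarrow> 0 < v \<bullet> (P *v v))"

(* X is a Gaussian random vector with mean m and covariance C
   (characteristic-function definition, allows singular C) *)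
definition gaussian_vec :: "'a measure \<Rightarrow> ('a \<Rightarrow> real^'n) \<Rightarrow> real^'n \<Rightarrow> real^'n^'n \<Rightarrow> bool" where
  "gaussian_vec M X m C \<longleftrightarrow> X \<in> borel_measurable M \<and> transpose C = C \<and>
     (\<forall>t. prob_space.expectation M (\<lambda>\<omega>. exp (\<i> * complex_of_real (t \<bullet> X \<omega>)))
          = exp (\<i> * complex_of_real (t \<bullet> m) - complex_of_real ((t \<bullet> (C *v t)) / 2)))"

(* Riccati recursion: S_{N+1} = Q_{N+1},
   S_k = Q_k + A^T S_{k+1} A - K_k^T (R_k + B^T S_{k+1} B) K_k *)
function riccS :: "real^'n^'n \<Rightarrow> real^'m^'n \<Rightarrow> (nat \<Rightarrow> real^'n^'n) \<Rightarrow> (nat \<Rightarrow> real^'m^'m)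
                   \<Rightarrow> nat \<Rightarrow> nat \<Rightarrow> real^'n^'n" where
  "riccS A B Q R N k =
     (if N < k then Q (N+1)
      else (let S' = riccS A B Q R N (Suc k);
                G = R k + transpose B ** S' ** B;
                K = matrix_inv G ** transpose B ** S' ** A
            in Q k + transpose A ** S' ** A - transpose K ** G ** K))"
  by pat_completeness auto
termination by (relation "Wellfounded.measure (\<lambda>(A,B,Q,R,N,k). Suc N - k)") auto

definition riccK :: "real^'n^'n \<Rightarrow> real^'m^'n \<Rightarrow> (nat \<Rightarrow> real^'n^'n) \<Rightarrow> (nat \<Rightarrow> real^'m^'m)
                   \<Rightarrow> nat \<Rightarrow> nat \<Rightarrow> real^'n^'m" where
  "riccK A B Q R N k =
     matrix_inv (R k + transpose B ** riccS A B Q R N (Suc k) ** B)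
       ** transpose B ** riccS A B Q R N (Suc k) ** A"

(* Gamma_k = K_k^T (B^T S_{k+1} B + R_k) K_k *)
definition riccGamma :: "real^'n^'n \<Rightarrow> real^'m^'n \<Rightarrow> (nat \<Rightarrow> real^'n^'n) \<Rightarrow> (nat \<Rightarrow> real^'m^'m)
                   \<Rightarrow> nat \<Rightarrow> nat \<Rightarrow> real^'n^'n" where
  "riccGamma A B Q R N k =
     transpose (riccK A B Q R N k)
       ** (transpose B ** riccS A B Q R N (Suc k) ** B + R k) ** riccK A B Q R N k"

(* Closed-loop trajectory for one realisation: given the initial state x0,
   disturbances w, age-of-information sequence eta and gains K, with
   u_k = - K_k xhat_k,
   xhat_k = A^{eta_k} x_{k-eta_k} + sum_{t=1}^{eta_k} A^{t-1} B u_{k-t},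
   x_{k+1} = A x_k + B u_k + w_k.
   traj ... k = ([x_0,...,x_k], [u_0,...,u_{k-1}]). *)
definition xhat :: "real^'n^'n \<Rightarrow> real^'m^'n \<Rightarrow> nat \<Rightarrow> nat
                    \<Rightarrow> (real^'n) list \<Rightarrow> (real^'m) list \<Rightarrow> real^'n" where
  "xhat A B e k xs us = mpow A e *v (xs ! (k - e))
      + (\<Sum>t = 1..e. mpow A (t - 1) *v (B *v (us ! (k - t))))"

fun traj :: "real^'n^'n \<Rightarrow> real^'m^'n \<Rightarrow> (nat \<Rightarrow> real^'n^'m) \<Rightarrow> (nat \<Rightarrow> nat)
             \<Rightarrow> real^'n \<Rightarrow> (nat \<Rightarrow> real^'n) \<Rightarrow> nat \<Rightarrow> (real^'n) list \<times> (real^'m) list" where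
  "traj A B K eta x0 w 0 = ([x0], [])"
| "traj A B K eta x0 w (Suc k) =
     (let (xs, us) = traj A B K eta x0 w k;
          uk = - (K k *v xhat A B (eta k) k xs us)
      in (xs @ [A *v (xs ! k) + B *v uk + w k], us @ [uk]))"

definition state :: "real^'n^'n \<Rightarrow> real^'m^'n \<Rightarrow> (nat \<Rightarrow> real^'n^'m) \<Rightarrow> (nat \<Rightarrow> nat)
             \<Rightarrow> real^'n \<Rightarrow> (nat \<Rightarrow> real^'n) \<Rightarrow> nat \<Rightarrow> real^'n" where
  "state A B K eta x0 w k = fst (traj A B K eta x0 w k) ! k"

definition input :: "real^'n^'n \<Rightarrow> real^'m^'n \<Rightarrow> (nat \<Rightarrow> real^'n^'m) \<Rightarrow> (nat \<Rightarrow> nat)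
             \<Rightarrow> real^'n \<Rightarrow> (nat \<Rightarrow> real^'n) \<Rightarrow> nat \<Rightarrow> real^'m" where
  "input A B K eta x0 w k = snd (traj A B K eta x0 w (Suc k)) ! k"

(* pathwise realised cost
   x_{N+1}^T Q_{N+1} x_{N+1} + sum_{k=0}^N (-theta_k eta_k + x_k^T Q_k x_k + u_k^T R_k u_k) *)
definition path_cost :: "real^'n^'n \<Rightarrow> real^'m^'n \<Rightarrow> (nat \<Rightarrow> real^'n^'m)
     \<Rightarrow> (nat \<Rightarrow> real^'n^'n) \<Rightarrow> (nat \<Rightarrow> real^'m^'m) \<Rightarrow> (nat \<Rightarrow> real) \<Rightarrow> nat
     \<Rightarrow> (nat \<Rightarrow> nat) \<Rightarrow> real^'n \<Rightarrow> (nat \<Rightarrow> real^'n) \<Rightarrow> real" where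
  "path_cost A B K Q R \<theta> N eta x0 w =
     (let x = state A B K eta x0 w; u = input A B K eta x0 w in
      x (N+1) \<bullet> (Q (N+1) *v x (N+1))
      + (\<Sum>k = 0..N. - \<theta> k * real (eta k) + x k \<bullet> (Q k *v x k) + u k \<bullet> (R k *v u k)))"

(* chi(pi, mu^* ) for a (random) queuing policy eta :: nat => 'a => nat,
   with mu^* : u_k = - K_k xhat_k *)
definition chi :: "'a measure \<Rightarrow> real^'n^'n \<Rightarrow> real^'m^'n
     \<Rightarrow> (nat \<Rightarrow> real^'n^'n) \<Rightarrow> (nat \<Rightarrow> real^'m^'m) \<Rightarrow> (nat \<Rightarrow> real) \<Rightarrow> nat
     \<Rightarrow> ('a \<Rightarrow> real^'n) \<Rightarrow> (nat \<Rightarrow> 'a \<Rightarrow> real^'n) \<Rightarrow> (nat \<Rightarrow> 'a \<Rightarrow> nat) \<Rightarrow> real" where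
  "chi M A B Q R \<theta> N x0 w eta =
     prob_space.expectation M (\<lambda>\<omega>. path_cost A B (riccK A B Q R N) Q R \<theta> N
                                   (\<lambda>k. eta k \<omega>) (x0 \<omega>) (\<lambda>k. w k \<omega>))"

(* objective of the argmin defining pi' at time k *)
definition queue_obj :: "real^'n^'n \<Rightarrow> real^'n^'n \<Rightarrow> real \<Rightarrow> nat \<Rightarrow> (nat \<Rightarrow> real^'n) \<Rightarrow> nat \<Rightarrow> real" where
  "queue_obj A \<Gamma> th k w e =
     (let s = (\<Sum>t = 1..e. mpow A (t - 1) *v w (k - t)) in - th * real e + s \<bullet> (\<Gamma> *v s))"

(* pi': eta_0 = 0, eta_k = argmin over {0..eta_{k-1}+1} (ties broken towards the
   smallest age) *)
fun eta_plus :: "real^'n^'n \<Rightarrow> real^'m^'n \<Rightarrow> (nat \<Rightarrow> real^'n^'n) \<Rightarrow> (nat \<Rightarrow> real^'m^'m)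
     \<Rightarrow> (nat \<Rightarrow> real) \<Rightarrow> nat \<Rightarrow> (nat \<Rightarrow> real^'n) \<Rightarrow> nat \<Rightarrow> nat" where
  "eta_plus A B Q R \<theta> N w 0 = 0"
| "eta_plus A B Q R \<theta> N w (Suc k) =
     (let p = eta_plus A B Q R \<theta> N w k;
          f = queue_obj A (riccGamma A B Q R N (Suc k)) (\<theta> (Suc k)) (Suc k) w
      in LEAST e. e \<le> p + 1 \<and> (\<forall>e'\<le>p + 1. f e \<le> f e'))"

end

theory Submission
  imports Defs
begin

text \<open>
  Completing the square along the Riccati recursion writes the realised cost of the certainty
  equivalence controller \<open>u_k = -K_k xhat_k\<close> as
    \<open>x_0' S_0 x_0 + \<Sum>_k (-\<theta>_k \<eta>_k + e_k' \<Gamma>_k e_k + w_k' S_{k+1} w_k + 2 w_k' S_{k+1} (A x_k + B u_k))\<close>,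
  where \<open>e_k = \<Sum>_{t=1..\<eta>_k} A^{t-1} w_{k-t}\<close> is the estimation error.
  Under a causal queuing policy \<open>x_k\<close> and \<open>u_k\<close> depend only on \<open>x_0, w_0, \<dots>, w_{k-1}\<close>, so each
  cross term is a product of independent factors, one of them centred, and has mean zero.
  What remains differs between two policies only through the queuing terms
  \<open>-\<theta>_k \<eta>_k + e_k' \<Gamma>_k e_k\<close>: they vanish for the zero-wait policy and, age \<open>0\<close> being always
  admissible, are pathwise nonpositive for their minimiser \<open>\<pi>'\<close>.
  All expectations exist because the closed loop grows linearly in the Gaussian disturbances.
\<close>

section \<open>Matrix algebra\<close>

lemma inner_matrix_vector_transpose: "(x::real^'n) \<bullet> (A *v y) = (transpose A *v x) \<bullet> y"
  by (metis dot_lmul_matrix transpose_matrix_vector inner_commute transpose_transpose vector_transpose_matrix)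

lemma inner_symmetric_matrix: "transpose A = A \<Longrightarrow> (x::real^'n) \<bullet> (A *v y) = y \<bullet> (A *v x)"
  by (metis inner_matrix_vector_transpose inner_commute)

lemma inner_matrix_vector_congruence:
  "((B::real^'m^'n) *v u) \<bullet> (S *v (C *v v)) = u \<bullet> ((transpose B ** S ** C) *v v)"
  by (metis inner_matrix_vector_transpose inner_commute matrix_vector_mul_assoc matrix_mul_assoc)

lemma matrix_transpose_add: "transpose ((A::real^'n^'m) + B) = transpose A + transpose B"
  by (simp add: transpose_def vec_eq_iff)

lemma matrix_transpose_diff: "transpose ((A::real^'n^'m) - B) = transpose A - transpose B"
  by (simp add: transpose_def vec_eq_iff)

lemma invertible_matrix_inv:
  fixes G :: "real^'n^'n"
  assumes "invertible G"
  shows "G ** matrix_inv G = mat 1" "matrix_inv G ** G = mat 1"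
proof -
  from assms obtain G' where "G ** G' = mat 1 \<and> G' ** G = mat 1" unfolding invertible_def by blast
  then have "G ** matrix_inv G = mat 1 \<and> matrix_inv G ** G = mat 1"
    unfolding matrix_inv_def by (rule someI)
  then show "G ** matrix_inv G = mat 1" "matrix_inv G ** G = mat 1" by auto
qed

lemma pd_imp_invertible:
  fixes G :: "real^'n^'n"
  assumes "pd G"
  shows "invertible G"
proof -
  have "G *v x = 0 \<Longrightarrow> x = 0" for x
    using assms unfolding pd_def by (metis inner_zero_right less_irrefl)
  then show ?thesis using matrix_left_invertible_ker invertible_left_inverse by blast
qed

lemma pd_add_psd_congruence:
  fixes R :: "real^'m^'m" and S :: "real^'n^'n" and B :: "real^'m^'n"
  assumes "pd R" and "psd S"
  shows "pd (R + transpose B ** S ** B)"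
  unfolding pd_def
proof (intro conjI allI impI)
  show "transpose (R + transpose B ** S ** B) = R + transpose B ** S ** B"
    using assms by (simp add: pd_def psd_def matrix_transpose_add matrix_transpose_mul matrix_mul_assoc)
  fix v :: "real^'m" assume "v \<noteq> 0"
  then have "0 < v \<bullet> (R *v v)" using assms(1) unfolding pd_def by simp
  moreover have "0 \<le> (B *v v) \<bullet> (S *v (B *v v))" using assms(2) unfolding psd_def by simp
  ultimately show "0 < v \<bullet> ((R + transpose B ** S ** B) *v v)"
    by (simp add: matrix_vector_mult_add_rdistrib inner_add_right inner_matrix_vector_congruence)
qed

lemma norm_matrix_vector_le: "norm ((P::real^'n^'m) *v x) \<le> onorm ((*v) P) * norm x"
  by (rule onorm) simp

lemma onorm_matrix_nonneg: "0 \<le> onorm ((*v) (P::real^'n^'m))"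
  by (rule onorm_pos_le) simp

lemma norm_matrix_vector_le_bound:
  "norm x \<le> c \<Longrightarrow> norm ((P::real^'n^'m) *v x) \<le> onorm ((*v) P) * c"
  by (rule order_trans[OF norm_matrix_vector_le mult_left_mono]) (simp_all add: onorm_matrix_nonneg)

lemma abs_inner_matrix_vector_le:
  assumes "norm x \<le> a" and "norm y \<le> b"
  shows "\<bar>x \<bullet> ((P::real^'n^'m) *v y)\<bar> \<le> onorm ((*v) P) * (a * b)"
proof -
  have "\<bar>x \<bullet> (P *v y)\<bar> \<le> norm x * norm (P *v y)" by (rule Cauchy_Schwarz_ineq2)
  also have "\<dots> \<le> a * (onorm ((*v) P) * b)"
    using assms by (intro mult_mono norm_matrix_vector_le_bound) (auto intro: order_trans[OF norm_ge_zero])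
  finally show ?thesis by (simp add: algebra_simps)
qed

section \<open>The Riccati recursion\<close>

declare riccS.simps[simp del]

lemma completion_of_squares:
  fixes A :: "real^'n^'n" and B :: "real^'m^'n" and Q S' :: "real^'n^'n" and R :: "real^'m^'m"
  defines "G \<equiv> R + transpose B ** S' ** B"
  defines "K \<equiv> matrix_inv G ** transpose B ** S' ** A"
  assumes S'_sym: "transpose S' = S'" and R_sym: "transpose R = R" and G_inv: "invertible G"
  shows "x \<bullet> (Q *v x) + u \<bullet> (R *v u) + (A *v x + B *v u + w) \<bullet> (S' *v (A *v x + B *v u + w))
           - x \<bullet> ((Q + transpose A ** S' ** A - transpose K ** G ** K) *v x)
         = (u + K *v x) \<bullet> (G *v (u + K *v x)) + 2 * (w \<bullet> (S' *v (A *v x + B *v u))) + w \<bullet> (S' *v w)"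
proof -
  have G_sym: "transpose G = G"
    unfolding G_def by (simp add: matrix_transpose_add matrix_transpose_mul R_sym S'_sym matrix_mul_assoc)
  have GK: "G ** K = transpose B ** S' ** A"
  proof -
    have "G ** K = (G ** matrix_inv G) ** (transpose B ** S' ** A)"
      unfolding K_def by (simp add: matrix_mul_assoc)
    then show ?thesis using invertible_matrix_inv(1)[OF G_inv] by (simp add: matrix_mul_lid)
  qed
  let ?y = "A *v x + B *v u"
  have "(?y + w) \<bullet> (S' *v (?y + w)) = ?y \<bullet> (S' *v ?y) + 2 * (w \<bullet> (S' *v ?y)) + w \<bullet> (S' *v w)"
    using inner_symmetric_matrix[OF S'_sym, of ?y w]
    by (simp add: matrix_vector_right_distrib inner_add_left inner_add_right)
  moreover have "?y \<bullet> (S' *v ?y) = (A *v x) \<bullet> (S' *v (A *v x)) + 2 * (u \<bullet> ((transpose B ** S' ** A) *v x))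
      + (B *v u) \<bullet> (S' *v (B *v u))"
    using inner_symmetric_matrix[OF S'_sym, of "A *v x" "B *v u"]
      inner_matrix_vector_congruence[of B u S' A x]
    by (simp add: matrix_vector_right_distrib inner_add_left inner_add_right)
  moreover have "u \<bullet> (R *v u) + (B *v u) \<bullet> (S' *v (B *v u)) = u \<bullet> (G *v u)"
    unfolding G_def inner_matrix_vector_congruence
    by (simp add: matrix_vector_mult_add_rdistrib inner_add_right)
  moreover have "x \<bullet> ((Q + transpose A ** S' ** A - transpose K ** G ** K) *v x)
      = x \<bullet> (Q *v x) + (A *v x) \<bullet> (S' *v (A *v x)) - (K *v x) \<bullet> (G *v (K *v x))"
    unfolding inner_matrix_vector_congruence
    by (simp add: matrix_vector_mult_add_rdistrib matrix_vector_mult_diff_rdistrib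
        inner_add_right inner_diff_right)
  moreover have "(u + K *v x) \<bullet> (G *v (u + K *v x)) = u \<bullet> (G *v u) + 2 * (u \<bullet> ((G ** K) *v x))
      + (K *v x) \<bullet> (G *v (K *v x))"
    using inner_symmetric_matrix[OF G_sym, of u "K *v x"]
    by (simp add: matrix_vector_right_distrib inner_add_left inner_add_right
        matrix_vector_mul_assoc[symmetric])
  ultimately show ?thesis using GK by simp
qed

lemma riccS_final: "riccS A B Q R N (Suc N) = Q (Suc N)"
  by (subst riccS.simps) simp

lemma riccS_step:
  "k \<le> N \<Longrightarrow> riccS A B Q R N k =
     Q k + transpose A ** riccS A B Q R N (Suc k) ** A
     - transpose (riccK A B Q R N k) ** (R k + transpose B ** riccS A B Q R N (Suc k) ** B)
         ** riccK A B Q R N k"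
  by (subst riccS.simps) (simp add: Let_def riccK_def)

context
  fixes A :: "real^'n^'n" and B :: "real^'m^'n"
    and Q :: "nat \<Rightarrow> real^'n^'n" and R :: "nat \<Rightarrow> real^'m^'m" and N :: nat
  assumes Q_psd: "\<And>k. k \<le> N + 1 \<Longrightarrow> psd (Q k)" and R_pd: "\<And>k. k \<le> N \<Longrightarrow> pd (R k)"
begin

lemma psd_riccS: "k \<le> N + 1 \<Longrightarrow> psd (riccS A B Q R N k)"
proof (induction k rule: inc_induct)
  case base
  then show ?case using Q_psd[of "N + 1"] by (simp add: riccS_final)
next
  case (step k)
  let ?S' = "riccS A B Q R N (Suc k)" and ?K = "riccK A B Q R N k"
  let ?G = "R k + transpose B ** ?S' ** B"
  have k: "k \<le> N" using step by simp
  have S'_sym: "transpose ?S' = ?S'" using step.IH unfolding psd_def by simp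
  have R_sym: "transpose (R k) = R k" using R_pd[OF k] unfolding pd_def by simp
  have G_pd: "pd ?G" using pd_add_psd_congruence[OF R_pd[OF k] step.IH] .
  have "transpose (riccS A B Q R N k) = riccS A B Q R N k"
    using G_pd S'_sym Q_psd[of k] k unfolding riccS_step[OF k] pd_def psd_def
    by (simp add: matrix_transpose_add matrix_transpose_diff matrix_transpose_mul matrix_mul_assoc)
  moreover have "0 \<le> v \<bullet> (riccS A B Q R N k *v v)" for v
  proof -
    \<comment> \<open>the feedback \<open>u = -K v\<close> annihilates the completed square\<close>
    let ?u = "- (?K *v v)" and ?v' = "A *v v + B *v - (?K *v v)"
    have "v \<bullet> (Q k *v v) + ?u \<bullet> (R k *v ?u) + ?v' \<bullet> (?S' *v ?v') = v \<bullet> (riccS A B Q R N k *v v)"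
      using completion_of_squares[where A = A and x = v and Q = "Q k" and u = ?u and w = 0,
          OF S'_sym R_sym pd_imp_invertible[OF G_pd]]
      unfolding riccS_step[OF k] riccK_def by simp
    moreover have "0 \<le> v \<bullet> (Q k *v v)" using Q_psd[of k] k unfolding psd_def by simp
    moreover have "0 \<le> ?u \<bullet> (R k *v ?u)"
      using R_pd[OF k] unfolding pd_def by (metis inner_zero_left less_eq_real_def)
    moreover have "0 \<le> ?v' \<bullet> (?S' *v ?v')" using step.IH unfolding psd_def by blast
    ultimately show ?thesis by linarith
  qed
  ultimately show ?case unfolding psd_def by blast
qed

lemma riccati_completion_of_squares:
  assumes k: "k \<le> N"
  defines "S \<equiv> riccS A B Q R N" and "K \<equiv> riccK A B Q R N"
  shows "x \<bullet> (Q k *v x) + u \<bullet> (R k *v u)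
           + (A *v x + B *v u + w) \<bullet> (S (Suc k) *v (A *v x + B *v u + w)) - x \<bullet> (S k *v x)
         = (u + K k *v x) \<bullet> ((R k + transpose B ** S (Suc k) ** B) *v (u + K k *v x))
           + 2 * (w \<bullet> (S (Suc k) *v (A *v x + B *v u))) + w \<bullet> (S (Suc k) *v w)"
proof -
  have S'_psd: "psd (S (Suc k))" unfolding S_def using psd_riccS k by simp
  have S'_sym: "transpose (S (Suc k)) = S (Suc k)" using S'_psd unfolding psd_def by simp
  have R_sym: "transpose (R k) = R k" using R_pd[OF k] unfolding pd_def by simp
  have G_inv: "invertible (R k + transpose B ** S (Suc k) ** B)"
    using pd_imp_invertible[OF pd_add_psd_congruence[OF R_pd[OF k] S'_psd]] .
  show ?thesis
    using completion_of_squares[where A = A and Q = "Q k", OF S'_sym R_sym G_inv]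
    unfolding S_def K_def riccS_step[OF k] riccK_def by simp
qed

end


section \<open>Closed-loop trajectories\<close>

lemma length_traj:
  "length (fst (traj A B K eta x0 w k)) = Suc k \<and> length (snd (traj A B K eta x0 w k)) = k"
  by (induction k) (auto simp: Let_def split_beta)

lemma traj_Suc_nth:
  "fst (traj A B K eta x0 w (Suc k)) ! Suc k
     = A *v (fst (traj A B K eta x0 w k) ! k) + B *v (snd (traj A B K eta x0 w (Suc k)) ! k) + w k"
  "snd (traj A B K eta x0 w (Suc k)) ! k
     = - (K k *v xhat A B (eta k) k (fst (traj A B K eta x0 w k)) (snd (traj A B K eta x0 w k)))"
  using length_traj[of A B K eta x0 w k] by (simp_all add: Let_def split_beta nth_append)

lemma traj_prefix_nth:
  "j \<le> k \<Longrightarrow> fst (traj A B K eta x0 w k) ! j = state A B K eta x0 w j"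
  "j < k \<Longrightarrow> snd (traj A B K eta x0 w k) ! j = input A B K eta x0 w j"
proof (induction k)
  case (Suc k)
  { case 1 then show ?case
      using Suc length_traj[of A B K eta x0 w k]
      by (cases "j = Suc k") (simp_all add: state_def Let_def split_beta nth_append)
  next
    case 2 then show ?case
      using Suc length_traj[of A B K eta x0 w k]
      by (cases "j = k") (simp_all add: input_def Let_def split_beta nth_append) }
qed (simp_all add: state_def)

lemma state_0: "state A B K eta x0 w 0 = x0"
  by (simp add: state_def)

lemma state_Suc:
  "state A B K eta x0 w (Suc k) = A *v state A B K eta x0 w k + B *v input A B K eta x0 w k + w k"
  by (simp only: state_def input_def traj_Suc_nth(1))

definition estimate :: "real^'n^'n \<Rightarrow> real^'m^'n \<Rightarrow> (nat \<Rightarrow> real^'n^'m) \<Rightarrow> (nat \<Rightarrow> nat)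
    \<Rightarrow> real^'n \<Rightarrow> (nat \<Rightarrow> real^'n) \<Rightarrow> nat \<Rightarrow> real^'n" where
  "estimate A B K eta x0 w k = mpow A (eta k) *v state A B K eta x0 w (k - eta k)
     + (\<Sum>t = 1..eta k. mpow A (t - 1) *v (B *v input A B K eta x0 w (k - t)))"

lemma input_feedback:
  assumes "eta k \<le> k"
  shows "input A B K eta x0 w k = - (K k *v estimate A B K eta x0 w k)"
proof -
  have "xhat A B (eta k) k (fst (traj A B K eta x0 w k)) (snd (traj A B K eta x0 w k))
      = estimate A B K eta x0 w k"
    using assms unfolding xhat_def estimate_def by (simp add: traj_prefix_nth)
  then show ?thesis unfolding input_def traj_Suc_nth(2) by simp
qed

lemma mpow_commute: "mpow A e ** A = A ** mpow A e"
proof (induction e)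
  case (Suc e)
  then show ?case by (metis matrix_mul_assoc mpow.simps(2))
qed (simp add: matrix_mul_lid matrix_mul_rid)

lemma state_unfold:
  "e \<le> k \<Longrightarrow> state A B K eta x0 w k = mpow A e *v state A B K eta x0 w (k - e)
     + (\<Sum>t = 1..e. mpow A (t - 1) *v (B *v input A B K eta x0 w (k - t) + w (k - t)))"
proof (induction e)
  case (Suc e)
  have k: "k - e = Suc (k - Suc e)" using Suc by simp
  have "mpow A e *v state A B K eta x0 w (k - e) = mpow A (Suc e) *v state A B K eta x0 w (k - Suc e)
     + mpow A e *v (B *v input A B K eta x0 w (k - Suc e) + w (k - Suc e))"
    unfolding k state_Suc
    by (simp add: matrix_vector_right_distrib matrix_vector_mul_assoc mpow_commute)
  then show ?case using Suc by (simp add: add.assoc)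
qed simp

definition estimation_error :: "real^'n^'n \<Rightarrow> (nat \<Rightarrow> nat) \<Rightarrow> (nat \<Rightarrow> real^'n) \<Rightarrow> nat \<Rightarrow> real^'n" where
  "estimation_error A eta w k = (\<Sum>t = 1..eta k. mpow A (t - 1) *v w (k - t))"

lemma state_minus_estimate:
  "eta k \<le> k \<Longrightarrow> state A B K eta x0 w k - estimate A B K eta x0 w k = estimation_error A eta w k"
  using state_unfold[of "eta k" k A B K eta x0 w]
  by (simp add: estimate_def estimation_error_def matrix_vector_right_distrib sum.distrib)

lemma state_input_causal:
  assumes "\<forall>i<k. w i = w' i" "\<forall>j\<le>k. eta j = eta' j" "\<forall>j. eta j \<le> j" "\<forall>j. eta' j \<le> j"
  shows "state A B K eta x0 w k = state A B K eta' x0 w' k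
       \<and> input A B K eta x0 w k = input A B K eta' x0 w' k"
  using assms
proof (induction k rule: less_induct)
  case (less k)
  have IH: "state A B K eta x0 w j = state A B K eta' x0 w' j
      \<and> input A B K eta x0 w j = input A B K eta' x0 w' j" if "j < k" for j
    using less.IH[OF that] less.prems that by auto
  have state: "state A B K eta x0 w k = state A B K eta' x0 w' k"
    using IH less.prems by (cases k) (simp_all add: state_0 state_Suc)
  have eta_k: "eta k = eta' k" "eta k \<le> k" using less.prems by simp_all
  have "state A B K eta x0 w (k - eta k) = state A B K eta' x0 w' (k - eta k)"
    using state IH[of "k - eta k"] eta_k(2) by (cases "eta k = 0") auto
  moreover have "input A B K eta x0 w (k - t) = input A B K eta' x0 w' (k - t)" if "t \<in> {1..eta k}" for t
    using IH[of "k - t"] that eta_k by auto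
  ultimately have "estimate A B K eta x0 w k = estimate A B K eta' x0 w' k"
    unfolding estimate_def eta_k(1)[symmetric] by (metis (no_types, lifting) sum.cong)
  then show ?case
    using state input_feedback[of eta k A B K x0 w] input_feedback[of eta' k A B K x0 w'] less.prems
    by simp
qed

lemma path_cost_causal:
  assumes "\<forall>i\<le>N. w i = w' i" "\<forall>j\<le>N+1. eta j = eta' j" "\<forall>j. eta j \<le> j" "\<forall>j. eta' j \<le> j"
  shows "path_cost A B K Q R \<theta> N eta x0 w = path_cost A B K Q R \<theta> N eta' x0 w'"
proof -
  have si: "state A B K eta x0 w j = state A B K eta' x0 w' j
      \<and> input A B K eta x0 w j = input A B K eta' x0 w' j" if "j \<le> N + 1" for j
    by (rule state_input_causal) (use assms that in auto)
  show ?thesis unfolding path_cost_def Let_def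
    using si[of "N + 1"] si assms(2) by (intro arg_cong2[where f = "(+)"] sum.cong) auto
qed


section \<open>The cost along a trajectory\<close>

lemma path_cost_expansion:
  fixes A :: "real^'n^'n" and B :: "real^'m^'n" and x0 :: "real^'n" and w :: "nat \<Rightarrow> real^'n"
  assumes Q_psd: "\<And>k. k \<le> N + 1 \<Longrightarrow> psd (Q k)" and R_pd: "\<And>k. k \<le> N \<Longrightarrow> pd (R k)"
    and eta: "\<And>k. eta k \<le> k"
  defines "S \<equiv> riccS A B Q R N" and "x \<equiv> state A B (riccK A B Q R N) eta x0 w"
    and "u \<equiv> input A B (riccK A B Q R N) eta x0 w" and "e \<equiv> estimation_error A eta w"
  shows "path_cost A B (riccK A B Q R N) Q R \<theta> N eta x0 w =
    x0 \<bullet> (S 0 *v x0) +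
    (\<Sum>k = 0..N. - \<theta> k * real (eta k) + e k \<bullet> (riccGamma A B Q R N k *v e k)
       + 2 * (w k \<bullet> (S (Suc k) *v (A *v x k + B *v u k))) + w k \<bullet> (S (Suc k) *v w k))"
proof -
  let ?K = "riccK A B Q R N"
  let ?V = "\<lambda>k. x k \<bullet> (S k *v x k)"
  \<comment> \<open>\<open>?V\<close> telescopes, and each increment is a completed square in \<open>u k + K k x k = K k e k\<close>\<close>
  have stage: "x k \<bullet> (Q k *v x k) + u k \<bullet> (R k *v u k) + (?V (Suc k) - ?V k) =
      e k \<bullet> (riccGamma A B Q R N k *v e k)
      + 2 * (w k \<bullet> (S (Suc k) *v (A *v x k + B *v u k))) + w k \<bullet> (S (Suc k) *v w k)"
    if k: "k \<le> N" for k
  proof -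
    have "u k + ?K k *v x k = ?K k *v e k"
      using input_feedback[where A = A and B = B and K = ?K and eta = eta and k = k and ?x0.0 = x0 and w = w]
        state_minus_estimate[where A = A and B = B and K = ?K and eta = eta and k = k and ?x0.0 = x0 and w = w]
        eta[of k]
      unfolding x_def u_def e_def by (simp add: matrix_vector_mult_diff_distrib[symmetric])
    moreover have "(?K k *v e k) \<bullet> ((R k + transpose B ** S (Suc k) ** B) *v (?K k *v e k))
        = e k \<bullet> (riccGamma A B Q R N k *v e k)"
      unfolding inner_matrix_vector_congruence riccGamma_def S_def by (simp add: add.commute)
    ultimately show ?thesis
      using riccati_completion_of_squares[where Q = Q and R = R and N = N, OF Q_psd R_pd k,
          where A = A and B = B and x = "x k" and u = "u k" and w = "w k"]
      unfolding S_def x_def u_def by (simp add: state_Suc)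
  qed
  have "path_cost A B ?K Q R \<theta> N eta x0 w
      = ?V (Suc N) + (\<Sum>k = 0..N. - \<theta> k * real (eta k) + x k \<bullet> (Q k *v x k) + u k \<bullet> (R k *v u k))"
    unfolding path_cost_def S_def x_def u_def by (simp add: Let_def riccS_final)
  also have "\<dots> = ?V 0 + (\<Sum>k = 0..N. - \<theta> k * real (eta k)
      + (x k \<bullet> (Q k *v x k) + u k \<bullet> (R k *v u k) + (?V (Suc k) - ?V k)))"
  proof -
    have "(\<Sum>k = 0..N. ?V (Suc k) - ?V k) = ?V (Suc N) - ?V 0"
      by (rule sum_Suc_diff) simp
    moreover have "(\<Sum>k = 0..N. - \<theta> k * real (eta k)
        + (x k \<bullet> (Q k *v x k) + u k \<bullet> (R k *v u k) + (?V (Suc k) - ?V k)))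
      = (\<Sum>k = 0..N. - \<theta> k * real (eta k) + x k \<bullet> (Q k *v x k) + u k \<bullet> (R k *v u k))
        + (\<Sum>k = 0..N. ?V (Suc k) - ?V k)"
      unfolding sum.distrib[symmetric] by (rule sum.cong) simp_all
    ultimately show ?thesis by simp
  qed
  also have "\<dots> = ?V 0 + (\<Sum>k = 0..N. - \<theta> k * real (eta k) + e k \<bullet> (riccGamma A B Q R N k *v e k)
      + 2 * (w k \<bullet> (S (Suc k) *v (A *v x k + B *v u k))) + w k \<bullet> (S (Suc k) *v w k))"
    using stage by (intro arg_cong[where f = "\<lambda>s. ?V 0 + s"] sum.cong) (simp_all add: add.assoc)
  finally show ?thesis unfolding x_def by (simp add: state_0)
qed

section \<open>The queuing policy\<close>

lemma eta_plus_Suc_minimizes: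
  "eta_plus A B Q R \<theta> N w (Suc k) \<le> eta_plus A B Q R \<theta> N w k + 1 \<and>
   (\<forall>e \<le> eta_plus A B Q R \<theta> N w k + 1.
      queue_obj A (riccGamma A B Q R N (Suc k)) (\<theta> (Suc k)) (Suc k) w (eta_plus A B Q R \<theta> N w (Suc k))
      \<le> queue_obj A (riccGamma A B Q R N (Suc k)) (\<theta> (Suc k)) (Suc k) w e)"
proof -
  define p where "p = eta_plus A B Q R \<theta> N w k"
  define f where "f = queue_obj A (riccGamma A B Q R N (Suc k)) (\<theta> (Suc k)) (Suc k) w"
  have "finite (f ` {..p + 1})" "f ` {..p + 1} \<noteq> {}" by auto
  then obtain e where "e \<in> {..p + 1}" "f e = Min (f ` {..p + 1})"
    using Min_in by (metis imageE)
  then have "e \<le> p + 1 \<and> (\<forall>e' \<le> p + 1. f e \<le> f e')" by auto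
  then have "(LEAST e. e \<le> p + 1 \<and> (\<forall>e' \<le> p + 1. f e \<le> f e')) \<le> p + 1 \<and>
      (\<forall>e' \<le> p + 1. f (LEAST e. e \<le> p + 1 \<and> (\<forall>e' \<le> p + 1. f e \<le> f e')) \<le> f e')"
    by (rule LeastI)
  then show ?thesis by (simp add: p_def f_def Let_def)
qed

lemma eta_plus_le: "eta_plus A B Q R \<theta> N w k \<le> k"
proof (induction k)
  case (Suc k)
  then show ?case using eta_plus_Suc_minimizes[of A B Q R \<theta> N w k] by linarith
qed simp

lemma queue_stage_cost_nonpos:
  "- \<theta> k * real (eta_plus A B Q R \<theta> N w k)
    + estimation_error A (eta_plus A B Q R \<theta> N w) w k
      \<bullet> (riccGamma A B Q R N k *v estimation_error A (eta_plus A B Q R \<theta> N w) w k) \<le> 0"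
proof (cases k)
  case (Suc j)
  \<comment> \<open>the zero age is always admissible, and its objective value is \<open>0\<close>\<close>
  then have "queue_obj A (riccGamma A B Q R N k) (\<theta> k) k w (eta_plus A B Q R \<theta> N w k)
      \<le> queue_obj A (riccGamma A B Q R N k) (\<theta> k) k w 0"
    using eta_plus_Suc_minimizes[of A B Q R \<theta> N w j] by blast
  then show ?thesis by (simp add: queue_obj_def estimation_error_def Let_def)
qed (simp add: estimation_error_def)

lemma eta_plus_causal:
  "\<forall>i<k. w i = w' i \<Longrightarrow> eta_plus A B Q R \<theta> N w k = eta_plus A B Q R \<theta> N w' k"
proof (induction k)
  case (Suc k)
  have "queue_obj A G th (Suc k) w e = queue_obj A G th (Suc k) w' e" for G th e
    unfolding queue_obj_def using Suc.prems by (simp add: Let_def)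
  then show ?case using Suc by (simp add: Let_def)
qed simp


section \<open>Measurability\<close>

lemma borel_measurable_matrix_vector_mult[measurable (raw)]:
  "f \<in> borel_measurable M \<Longrightarrow> (\<lambda>x. (A::real^'n^'m) *v f x) \<in> borel_measurable M"
  by (rule borel_measurable_continuous_on[OF matrix_vector_mult_linear_continuous_on])

lemma borel_measurable_vec_nth[measurable (raw)]:
  "f \<in> borel_measurable M \<Longrightarrow> (\<lambda>x. (f x :: real^'n) $ i) \<in> borel_measurable M"
  unfolding cart_eq_inner_axis by (intro borel_measurable_inner measurable_const) auto

lemma measurable_policy_compose:
  assumes "(\<lambda>v. eta v k) \<in> measurable (Pi\<^sub>M UNIV (\<lambda>_. borel)) (count_space UNIV)"
    and "\<And>i. W i \<in> borel_measurable M"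
  shows "(\<lambda>\<omega>. eta (\<lambda>i. W i \<omega>) k) \<in> measurable M (count_space UNIV)"
  using measurable_compose[OF measurable_PiM_single'[of UNIV W M "\<lambda>_. borel"] assms(1)] assms(2)
  by simp

lemma state_input_measurable:
  fixes A :: "real^'n^'n" and B :: "real^'m^'n"
  assumes X0: "X0 \<in> borel_measurable M" and W: "\<And>i. W i \<in> borel_measurable M"
    and E: "\<And>k. E k \<in> measurable M (count_space UNIV)" and E_le: "\<And>k \<omega>. E k \<omega> \<le> k"
  shows "(\<lambda>\<omega>. state A B K (\<lambda>k. E k \<omega>) (X0 \<omega>) (\<lambda>i. W i \<omega>) k) \<in> borel_measurable M \<and>
         (\<lambda>\<omega>. input A B K (\<lambda>k. E k \<omega>) (X0 \<omega>) (\<lambda>i. W i \<omega>) k) \<in> borel_measurable M"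
proof (induction k rule: less_induct)
  case (less k)
  let ?x = "\<lambda>j \<omega>. state A B K (\<lambda>k. E k \<omega>) (X0 \<omega>) (\<lambda>i. W i \<omega>) j"
  let ?u = "\<lambda>j \<omega>. input A B K (\<lambda>k. E k \<omega>) (X0 \<omega>) (\<lambda>i. W i \<omega>) j"
  have x_k: "?x k \<in> borel_measurable M"
  proof (cases k)
    case (Suc j)
    then have "?x j \<in> borel_measurable M" "?u j \<in> borel_measurable M" using less by auto
    then show ?thesis unfolding Suc state_Suc using W by measurable
  qed (simp add: state_0 X0)
  \<comment> \<open>the input uses the estimate for the random age \<open>E k\<close>; freeze the age to \<open>e\<close> first\<close>
  define F where "F e \<omega> = - (K k *v (mpow A (min e k) *v ?x (k - min e k) \<omega>
      + (\<Sum>t = 1..min e k. mpow A (t - 1) *v (B *v ?u (k - t) \<omega>))))" for e \<omega>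
  have x_le: "?x j \<in> borel_measurable M" if "j \<le> k" for j
    using that x_k less by (cases "j = k") auto
  have F: "F e \<in> borel_measurable M" for e
  proof -
    have "?x (k - min e k) \<in> borel_measurable M" by (rule x_le) simp
    moreover have "(\<lambda>\<omega>. \<Sum>t = 1..min e k. mpow A (t - 1) *v (B *v ?u (k - t) \<omega>)) \<in> borel_measurable M"
    proof (rule borel_measurable_sum)
      fix t assume "t \<in> {1..min e k}"
      then have "?u (k - t) \<in> borel_measurable M" using less by auto
      then show "(\<lambda>\<omega>. mpow A (t - 1) *v (B *v ?u (k - t) \<omega>)) \<in> borel_measurable M" by measurable
    qed
    ultimately show ?thesis unfolding F_def by measurable
  qed
  have "(\<lambda>\<omega>. F (E k \<omega>) \<omega>) \<in> borel_measurable M"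
    by (rule measurable_compose_countable'[where I = UNIV]) (auto intro: F E)
  moreover have "?u k \<omega> = F (E k \<omega>) \<omega>" for \<omega>
    using input_feedback[where eta = "\<lambda>k. E k \<omega>" and k = k and K = K and ?x0.0 = "X0 \<omega>"
        and w = "\<lambda>i. W i \<omega>" and A = A and B = B] E_le[of k \<omega>]
    by (simp add: F_def estimate_def min_absorb1)
  ultimately show ?case using x_k by simp
qed

lemma queue_obj_measurable[measurable]:
  "(\<And>i. W i \<in> borel_measurable M) \<Longrightarrow> (\<lambda>\<omega>. queue_obj A G th k (\<lambda>i. W i \<omega>) e) \<in> borel_measurable M"
  unfolding queue_obj_def Let_def
  by (intro borel_measurable_add borel_measurable_const borel_measurable_inner
      borel_measurable_matrix_vector_mult borel_measurable_sum)

lemma eta_plus_measurable: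
  assumes W: "\<And>i. W i \<in> borel_measurable M"
  shows "(\<lambda>\<omega>. eta_plus A B Q R \<theta> N (\<lambda>i. W i \<omega>) k) \<in> measurable M (count_space UNIV)"
proof (induction k)
  case (Suc k)
  let ?p = "\<lambda>\<omega>. eta_plus A B Q R \<theta> N (\<lambda>i. W i \<omega>) k"
  let ?f = "\<lambda>\<omega>. queue_obj A (riccGamma A B Q R N (Suc k)) (\<theta> (Suc k)) (Suc k) (\<lambda>i. W i \<omega>)"
  have [measurable]: "?p \<in> measurable M (count_space UNIV)" by (rule Suc)
  have [measurable]: "(\<lambda>\<omega>. ?f \<omega> e) \<in> borel_measurable M" for e using W by measurable
  have "(\<lambda>\<omega>. LEAST e. e \<le> ?p \<omega> + 1 \<and> (\<forall>e'\<le>?p \<omega> + 1. ?f \<omega> e \<le> ?f \<omega> e'))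
      \<in> measurable M (count_space UNIV)"
    by measurable
  then show ?case by (simp add: Let_def)
qed simp

lemma eta_plus_measurable_sequences:
  "(\<lambda>v. eta_plus A B Q R \<theta> N v k) \<in> measurable (Pi\<^sub>M UNIV (\<lambda>_. borel)) (count_space UNIV)"
  using eta_plus_measurable[where W = "\<lambda>i v. v i" and M = "Pi\<^sub>M UNIV (\<lambda>_. borel)"]
  by (simp add: measurable_component_singleton)


section \<open>Moments of Gaussian vectors\<close>

lemma axis_quadratic_form: "axis i s \<bullet> ((C::real^'n^'n) *v axis i s) = s * s * C $ i $ i"
proof -
  have "(C *v axis i s) $ i = (\<Sum>k\<in>UNIV. C $ i $ k * (if k = i then s else 0))"
    by (simp add: matrix_vector_mult_def axis_def)
  also have "\<dots> = (\<Sum>k\<in>UNIV. if k = i then C $ i $ k * s else 0)"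
    by (rule sum.cong) auto
  finally show ?thesis unfolding inner_axis' by simp
qed

lemma (in prob_space) gaussian_vec_component_char:
  assumes "gaussian_vec M X m C"
  shows "(CLINT \<omega>|M. iexp (s * X \<omega> $ i))
    = exp (\<i> * complex_of_real (s * m $ i) - complex_of_real (s * s * C $ i $ i / 2))"
  using assms[unfolded gaussian_vec_def, THEN conjunct2, THEN conjunct2, rule_format, of "axis i s"]
  unfolding axis_quadratic_form by (simp add: inner_axis')

lemma (in prob_space) char_bounded_imp_variance_nonneg:
  assumes Y: "Y \<in> borel_measurable M"
    and char: "\<And>s. (CLINT \<omega>|M. iexp (s * Y \<omega>))
      = exp (\<i> * complex_of_real (s * \<mu>) - complex_of_real (s * s * c / 2))"
  shows "0 \<le> c"
proof (rule ccontr)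
  assume "\<not> 0 \<le> c"
  then have "1 < exp (- c / 2)" by simp
  also have "exp (- c / 2) = norm (CLINT \<omega>|M. iexp (1 * Y \<omega>))"
    unfolding char by (simp add: norm_exp_eq_Re)
  also have "\<dots> \<le> (LINT \<omega>|M. norm (iexp (1 * Y \<omega>)))" by (rule integral_norm_bound)
  also have "\<dots> = 1" by (simp add: prob_space norm_exp_eq_Re)
  finally show False by simp
qed

lemma (in prob_space) char_iexp_imp_AE_eq:
  assumes Y[measurable]: "Y \<in> borel_measurable M"
    and char: "\<And>s. (CLINT \<omega>|M. iexp (s * Y \<omega>)) = iexp (s * \<mu>)"
  shows "AE \<omega> in M. Y \<omega> = \<mu>"
proof -
  let ?Z = "\<lambda>\<omega>. Y \<omega> - \<mu>"
  have "char (distr M borel ?Z) = char (return borel 0)"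
  proof
    fix s
    have "char (distr M borel ?Z) s = (CLINT \<omega>|M. iexp (s * ?Z \<omega>))"
      unfolding char_def by (subst integral_distr) auto
    also have "\<dots> = (CLINT \<omega>|M. iexp (- s * \<mu>) * iexp (s * Y \<omega>))"
      by (intro Bochner_Integration.integral_cong refl) (simp add: algebra_simps mult_exp_exp)
    also have "\<dots> = iexp (- s * \<mu>) * (CLINT \<omega>|M. iexp (s * Y \<omega>))" by simp
    also have "\<dots> = 1" unfolding char by (simp add: mult_exp_exp)
    finally show "char (distr M borel ?Z) s = char (return borel 0) s"
      unfolding char_def by (subst integral_return) auto
  qed
  then have "distr M borel ?Z = return borel 0"
    by (rule Levy_uniqueness[rotated 2])
      (auto simp: real_distribution_def real_distribution_axioms_def prob_space_return
        intro!: prob_space_distr)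
  moreover have "AE x in return borel (0::real). x = 0" by (subst AE_return) auto
  ultimately have "AE x in distr M borel ?Z. x = 0" by metis
  then show ?thesis by (subst (asm) AE_distr_iff) auto
qed

lemma (in prob_space) char_gaussian_imp_std_normal:
  assumes Y[measurable]: "Y \<in> borel_measurable M" and c: "0 < c"
    and char: "\<And>s. (CLINT \<omega>|M. iexp (s * Y \<omega>))
      = exp (\<i> * complex_of_real (s * \<mu>) - complex_of_real (s * s * c / 2))"
  shows "distr M borel (\<lambda>\<omega>. (Y \<omega> - \<mu>) / sqrt c) = std_normal_distribution"
proof -
  let ?Z = "\<lambda>\<omega>. (Y \<omega> - \<mu>) / sqrt c"
  have char_Z: "char (distr M borel ?Z) = char std_normal_distribution"
  proof
    fix s
    have "char (distr M borel ?Z) s = (CLINT \<omega>|M. iexp (s * ?Z \<omega>))"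
      unfolding char_def by (subst integral_distr) auto
    also have "\<dots> = (CLINT \<omega>|M. iexp (- (s / sqrt c) * \<mu>) * iexp ((s / sqrt c) * Y \<omega>))"
      by (intro Bochner_Integration.integral_cong refl)
        (simp add: algebra_simps mult_exp_exp diff_divide_distrib)
    also have "\<dots> = iexp (- (s / sqrt c) * \<mu>) * (CLINT \<omega>|M. iexp ((s / sqrt c) * Y \<omega>))"
      by simp
    also have "\<dots> = exp (- complex_of_real (s * s / 2))"
    proof -
      have "(s / sqrt c) * (s / sqrt c) * c = s * s" using c by (simp add: field_simps)
      then show ?thesis unfolding char by (simp add: mult_exp_exp algebra_simps)
    qed
    also have "\<dots> = char std_normal_distribution s"
      unfolding char_std_normal_distribution by (simp add: power2_eq_square flip: exp_of_real)
    finally show "char (distr M borel ?Z) s = char std_normal_distribution s" .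
  qed
  show ?thesis by (rule Levy_uniqueness[OF _ real_dist_normal_dist char_Z]) simp
qed

lemma (in prob_space) char_gaussian_moments:
  assumes Y[measurable]: "Y \<in> borel_measurable M"
    and char: "\<And>s. (CLINT \<omega>|M. iexp (s * Y \<omega>))
      = exp (\<i> * complex_of_real (s * \<mu>) - complex_of_real (s * s * c / 2))"
  shows "integrable M (\<lambda>\<omega>. (Y \<omega>)^2)" "integrable M Y" "expectation Y = \<mu>"
proof -
  consider "c = 0" | "0 < c"
    using char_bounded_imp_variance_nonneg[OF Y char] by linarith
  then have "integrable M (\<lambda>\<omega>. (Y \<omega>)^2) \<and> integrable M Y \<and> expectation Y = \<mu>"
  proof cases
    case 1
    then have ae: "AE \<omega> in M. Y \<omega> = \<mu>"
      using char by (intro char_iexp_imp_AE_eq) (simp_all add: mult_exp_exp)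
    have "integrable M (\<lambda>\<omega>. (Y \<omega>)^2)"
      by (rule integrable_cong_AE_imp[of _ "\<lambda>_. \<mu>^2"]) (use ae in auto)
    moreover have "integrable M Y"
      by (rule integrable_cong_AE_imp[of _ "\<lambda>_. \<mu>"]) (use ae in auto)
    moreover have "expectation Y = expectation (\<lambda>_. \<mu>)"
      by (rule integral_cong_AE) (use ae in auto)
    ultimately show ?thesis by (simp add: prob_space)
  next
    case 2
    define Z where "Z \<omega> = (Y \<omega> - \<mu>) / sqrt c" for \<omega>
    have [measurable]: "Z \<in> borel_measurable M" unfolding Z_def by measurable
    have dZ: "distr M borel Z = std_normal_distribution"
      unfolding Z_def using char_gaussian_imp_std_normal[OF Y 2 char] .
    have Z_sq: "integrable M (\<lambda>\<omega>. (Z \<omega>)^2)"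
      using integrable_std_normal_distribution_moment[of 2] unfolding dZ[symmetric]
      by (subst (asm) integrable_distr_eq) auto
    have Z_int: "integrable M Z"
      using integrable_std_normal_distribution_moment[of 1] unfolding dZ[symmetric]
      by (subst (asm) integrable_distr_eq) auto
    have "(LINT x|distr M borel Z. x ^ 1) = 0"
      unfolding dZ by (rule integral_std_normal_distribution_moment_odd) simp
    then have Z_mean: "expectation Z = 0" by (subst (asm) integral_distr) auto
    have Y_eq: "Y = (\<lambda>\<omega>. \<mu> + sqrt c * Z \<omega>)" using 2 by (auto simp: Z_def)
    have "(\<lambda>\<omega>. (Y \<omega>)^2) = (\<lambda>\<omega>. \<mu>^2 + (2 * \<mu> * sqrt c) * Z \<omega> + c * (Z \<omega>)^2)"
      using 2 by (subst Y_eq) (auto simp: power2_eq_square algebra_simps)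
    then have "integrable M (\<lambda>\<omega>. (Y \<omega>)^2)"
      using Z_int Z_sq by (simp del: power2_eq_square)
    moreover have "integrable M Y" "expectation Y = \<mu>"
      unfolding Y_eq using Z_int Z_mean by (simp_all add: prob_space)
    ultimately show ?thesis by blast
  qed
  then show "integrable M (\<lambda>\<omega>. (Y \<omega>)^2)" "integrable M Y" "expectation Y = \<mu>" by auto
qed

lemma (in prob_space) gaussian_vec_component_moments:
  assumes "gaussian_vec M X m C"
  shows "integrable M (\<lambda>\<omega>. (X \<omega> $ i)^2)" "integrable M (\<lambda>\<omega>. X \<omega> $ i)"
    "expectation (\<lambda>\<omega>. X \<omega> $ i) = m $ i"
proof -
  have "(\<lambda>\<omega>. X \<omega> $ i) \<in> borel_measurable M"
    using assms unfolding gaussian_vec_def by (intro borel_measurable_vec_nth) simp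
  from char_gaussian_moments[OF this gaussian_vec_component_char[OF assms]]
  show "integrable M (\<lambda>\<omega>. (X \<omega> $ i)^2)" "integrable M (\<lambda>\<omega>. X \<omega> $ i)"
    "expectation (\<lambda>\<omega>. X \<omega> $ i) = m $ i" .
qed


section \<open>Linear growth of the closed loop in the disturbances\<close>

definition disturbance_size :: "real^'n \<Rightarrow> (nat \<Rightarrow> real^'n) \<Rightarrow> nat \<Rightarrow> real" where
  "disturbance_size x0 w J = norm x0 + (\<Sum>i<J. norm (w i))"

lemma disturbance_size_nonneg: "0 \<le> disturbance_size x0 w J"
  unfolding disturbance_size_def by (simp add: sum_nonneg)

lemma disturbance_size_Suc: "disturbance_size x0 w J \<le> disturbance_size x0 w (Suc J)"
  unfolding disturbance_size_def by simp

lemma norm_initial_le_disturbance_size: "norm x0 \<le> disturbance_size x0 w J"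
  unfolding disturbance_size_def by (simp add: sum_nonneg)

lemma norm_le_disturbance_size: "i < J \<Longrightarrow> norm (w i) \<le> disturbance_size x0 w J"
  unfolding disturbance_size_def
  using member_le_sum[of i "{..<J}" "\<lambda>i. norm (w i)"] by (simp add: add_increasing)

lemma norm_state_Suc_le:
  "norm (state A B K eta x0 w (Suc k)) \<le> onorm ((*v) A) * norm (state A B K eta x0 w k)
     + onorm ((*v) B) * norm (input A B K eta x0 w k) + norm (w k)"
  unfolding state_Suc
  by (intro order_trans[OF norm_triangle_ineq add_right_mono] order_trans[OF norm_triangle_ineq add_mono]
      norm_matrix_vector_le)

lemma norm_estimate_le:
  fixes A :: "real^'n^'n" and B :: "real^'m^'n"
  assumes eta: "eta k \<le> k"
    and x: "\<forall>j\<le>k. norm (state A B K eta x0 w j) \<le> c" and u: "\<forall>j<k. norm (input A B K eta x0 w j) \<le> c"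
  defines "P \<equiv> \<Sum>i\<le>k. onorm ((*v) (mpow A i))"
  shows "norm (estimate A B K eta x0 w k) \<le> P * (1 + real k * onorm ((*v) B)) * c"
proof -
  have P: "onorm ((*v) (mpow A i)) \<le> P" if "i \<le> k" for i
    unfolding P_def using that by (intro member_le_sum) (auto simp: onorm_matrix_nonneg)
  have P_nonneg: "0 \<le> P" unfolding P_def by (intro sum_nonneg onorm_matrix_nonneg)
  have c: "0 \<le> c" using x norm_ge_zero order_trans by blast
  have head: "norm (mpow A (eta k) *v state A B K eta x0 w (k - eta k)) \<le> P * c"
    using norm_matrix_vector_le_bound[of _ c "mpow A (eta k)"] x P[OF eta] c
    by (meson diff_le_self mult_right_mono order_trans)
  have "norm (mpow A (t - 1) *v (B *v input A B K eta x0 w (k - t))) \<le> P * (onorm ((*v) B) * c)"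
    if "t \<in> {1..eta k}" for t
  proof -
    have "k - t < k" using that eta by auto
    then have "norm (B *v input A B K eta x0 w (k - t)) \<le> onorm ((*v) B) * c"
      using u by (intro norm_matrix_vector_le_bound) simp
    then show ?thesis
      using norm_matrix_vector_le_bound[of _ _ "mpow A (t - 1)"] P[of "t - 1"] that eta c
      by (meson onorm_matrix_nonneg mult_nonneg_nonneg mult_right_mono order_trans
          diff_le_self le_trans atLeastAtMost_iff)
  qed
  then have "norm (\<Sum>t = 1..eta k. mpow A (t - 1) *v (B *v input A B K eta x0 w (k - t)))
      \<le> (\<Sum>t = 1..eta k. P * (onorm ((*v) B) * c))"
    by (rule sum_norm_le)
  also have "\<dots> = real (eta k) * (P * (onorm ((*v) B) * c))" by simp
  also have "\<dots> \<le> real k * (P * (onorm ((*v) B) * c))"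
    using eta c P_nonneg by (intro mult_right_mono) (auto simp: onorm_matrix_nonneg)
  finally have tail: "norm (\<Sum>t = 1..eta k. mpow A (t - 1) *v (B *v input A B K eta x0 w (k - t)))
      \<le> real k * (P * (onorm ((*v) B) * c))" .
  from head tail have "norm (estimate A B K eta x0 w k) \<le> P * c + real k * (P * (onorm ((*v) B) * c))"
    unfolding estimate_def by (rule order_trans[OF norm_triangle_ineq add_mono])
  then show ?thesis by (simp add: algebra_simps)
qed

lemma norm_input_le_of_past:
  fixes A :: "real^'n^'n" and B :: "real^'m^'n"
  shows "\<exists>g\<ge>0. \<forall>eta x0 w c. eta k \<le> k \<longrightarrow>
    (\<forall>j\<le>k. norm (state A B K eta x0 w j) \<le> c) \<longrightarrow> (\<forall>j<k. norm (input A B K eta x0 w j) \<le> c) \<longrightarrow>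
    norm (input A B K eta x0 w k) \<le> g * c"
proof (intro exI conjI allI impI)
  let ?P = "\<Sum>i\<le>k. onorm ((*v) (mpow A i))"
  show "0 \<le> onorm ((*v) (K k)) * (?P * (1 + real k * onorm ((*v) B)))"
    by (intro mult_nonneg_nonneg add_nonneg_nonneg sum_nonneg) (simp_all add: onorm_matrix_nonneg)
  fix eta x0 w and c :: real
  assume "eta k \<le> k" "\<forall>j\<le>k. norm (state A B K eta x0 w j) \<le> c" "\<forall>j<k. norm (input A B K eta x0 w j) \<le> c"
  then show "norm (input A B K eta x0 w k) \<le> onorm ((*v) (K k)) * (?P * (1 + real k * onorm ((*v) B))) * c"
    unfolding input_feedback[where eta = eta and k = k, OF \<open>eta k \<le> k\<close>] norm_minus_cancel mult.assoc
    by (intro norm_matrix_vector_le_bound) (simp add: norm_estimate_le mult.assoc[symmetric])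
qed

lemma trajectory_linear_growth:
  fixes A :: "real^'n^'n" and B :: "real^'m^'n" and K :: "nat \<Rightarrow> real^'n^'m"
  shows "\<exists>C\<ge>0. \<forall>eta x0 w. (\<forall>i::nat. eta i \<le> i) \<longrightarrow> (\<forall>j\<le>J.
     norm (state A B K eta x0 w j) \<le> C * disturbance_size x0 w J
     \<and> norm (input A B K eta x0 w j) \<le> C * disturbance_size x0 w J)"
proof (induction J)
  case 0
  obtain g where g: "0 \<le> g" "\<And>eta x0 w c. eta 0 \<le> (0::nat) \<Longrightarrow> norm (state A B K eta x0 w 0) \<le> c
      \<Longrightarrow> norm (input A B K eta x0 w 0) \<le> g * c"
    using norm_input_le_of_past[of 0 A B K] by auto
  show ?case
  proof (intro exI[of _ "max 1 g"] conjI allI impI)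
    fix eta :: "nat \<Rightarrow> nat" and x0 :: "real^'n" and w and j :: nat assume eta: "\<forall>i. eta i \<le> i" and j: "j \<le> 0"
    let ?D = "disturbance_size x0 w 0"
    have D: "0 \<le> ?D" by (rule disturbance_size_nonneg)
    have x: "norm (state A B K eta x0 w 0) \<le> ?D"
      by (simp add: state_0 norm_initial_le_disturbance_size)
    have "?D \<le> max 1 g * ?D" "g * ?D \<le> max 1 g * ?D"
      using D mult_right_mono[of 1 "max 1 g" ?D] mult_right_mono[of g "max 1 g" ?D] by simp_all
    then show "norm (state A B K eta x0 w j) \<le> max 1 g * ?D"
      "norm (input A B K eta x0 w j) \<le> max 1 g * ?D"
      using x g(2)[of eta x0 w ?D] eta[rule_format, of 0] j by auto
  qed simp
next
  case (Suc J)
  obtain C where C: "0 \<le> C" "\<And>eta x0 w j. \<forall>i::nat. eta i \<le> i \<Longrightarrow> j \<le> J \<Longrightarrow>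
      norm (state A B K eta x0 w j) \<le> C * disturbance_size x0 w J
      \<and> norm (input A B K eta x0 w j) \<le> C * disturbance_size x0 w J"
    using Suc by blast
  obtain g where g: "0 \<le> g" "\<And>eta x0 w c. eta (Suc J) \<le> (Suc J::nat)
      \<Longrightarrow> \<forall>j\<le>Suc J. norm (state A B K eta x0 w j) \<le> c \<Longrightarrow> \<forall>j<Suc J. norm (input A B K eta x0 w j) \<le> c
      \<Longrightarrow> norm (input A B K eta x0 w (Suc J)) \<le> g * c"
    using norm_input_le_of_past[of "Suc J" A B K] by auto
  define C1 where "C1 = max C ((onorm ((*v) A) + onorm ((*v) B)) * C + 1)"
  have C1: "0 \<le> C1" "C \<le> C1" unfolding C1_def using C by auto
  show ?case
  proof (intro exI[of _ "max C1 (g * C1)"] conjI allI impI)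
    fix eta :: "nat \<Rightarrow> nat" and x0 :: "real^'n" and w and j :: nat assume eta: "\<forall>i. eta i \<le> i" and j: "j \<le> Suc J"
    let ?D = "disturbance_size x0 w (Suc J)"
    have D: "0 \<le> ?D" by (rule disturbance_size_nonneg)
    have CD: "C * disturbance_size x0 w J \<le> C1 * ?D"
      using mult_mono[OF C1(2) disturbance_size_Suc C1(1) disturbance_size_nonneg] .
    have old: "norm (state A B K eta x0 w i) \<le> C1 * ?D" "norm (input A B K eta x0 w i) \<le> C1 * ?D"
      if "i \<le> J" for i
      using C(2)[OF eta that, of x0 w] CD by auto
    have "norm (state A B K eta x0 w (Suc J)) \<le> onorm ((*v) A) * (C * ?D) + onorm ((*v) B) * (C * ?D) + ?D"
      using C(2)[OF eta order_refl, of x0 w] mult_left_mono[OF disturbance_size_Suc C(1), of x0 w J]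
      by (intro order_trans[OF norm_state_Suc_le] add_mono mult_left_mono norm_le_disturbance_size)
        (auto simp: onorm_matrix_nonneg)
    also have "\<dots> = ((onorm ((*v) A) + onorm ((*v) B)) * C + 1) * ?D" by (simp add: algebra_simps)
    also have "\<dots> \<le> C1 * ?D" unfolding C1_def using D by (intro mult_right_mono) auto
    finally have x: "norm (state A B K eta x0 w i) \<le> C1 * ?D" if "i \<le> Suc J" for i
      using old(1)[of i] that by (cases "i = Suc J") auto
    have u: "norm (input A B K eta x0 w i) \<le> C1 * ?D" if "i < Suc J" for i
      using old(2)[of i] that by simp
    have "norm (input A B K eta x0 w (Suc J)) \<le> g * (C1 * ?D)"
      using g(2) eta x u by blast
    moreover have "C1 * ?D \<le> max C1 (g * C1) * ?D" "g * (C1 * ?D) \<le> max C1 (g * C1) * ?D"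
      using D by (simp_all add: mult_right_mono flip: mult.assoc)
    ultimately show "norm (state A B K eta x0 w j) \<le> max C1 (g * C1) * ?D"
      "norm (input A B K eta x0 w j) \<le> max C1 (g * C1) * ?D"
      using x[OF j] u[of j] j by (auto simp: le_Suc_eq)
  qed (use C1 in simp)
qed


section \<open>The closed loop under a causal queuing policy\<close>

lemma power2_norm_vec: "(norm (x::real^'n))^2 = (\<Sum>j\<in>UNIV. (x $ j)^2)"
  unfolding power2_norm_eq_inner inner_vec_def by (simp add: power2_eq_square)

lemma power2_sum_le:
  fixes a :: real and b :: "nat \<Rightarrow> real"
  shows "(a + (\<Sum>i<n. b i))^2 \<le> 2 * a^2 + 2 * real n * (\<Sum>i<n. (b i)^2)"
proof -
  have "(a + (\<Sum>i<n. b i))^2 \<le> 2 * a^2 + 2 * (\<Sum>i<n. b i)^2"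
    using zero_le_power2[of "a - (\<Sum>i<n. b i)"] by (simp add: power2_eq_square algebra_simps)
  also have "(\<Sum>i<n. b i)^2 \<le> real n * (\<Sum>i<n. (b i)^2)"
    using sum_squared_le_sum_of_squares[of b "{..<n}"] by (simp add: mult.commute)
  finally show ?thesis by simp
qed

text \<open>
  A queuing policy is modelled as a function of the disturbance sequence; its causality
  (\<open>\<eta>_k\<close> depends on \<open>w_0, \<dots>, w_{k-1}\<close> only) is admissibility with respect to the queuing information.
\<close>

locale causal_closed_loop = prob_space M for M :: "'a measure" +
  fixes A :: "real^'n^'n" and B :: "real^'m^'n" and Q :: "nat \<Rightarrow> real^'n^'n" and R :: "nat \<Rightarrow> real^'m^'m"
    and \<theta> :: "nat \<Rightarrow> real" and N :: nat
    and x0 :: "'a \<Rightarrow> real^'n" and w :: "nat \<Rightarrow> 'a \<Rightarrow> real^'n"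
    and policy :: "(nat \<Rightarrow> real^'n) \<Rightarrow> nat \<Rightarrow> nat"
  assumes x0_measurable[measurable]: "x0 \<in> borel_measurable M"
    and w_measurable[measurable]: "\<And>i. w i \<in> borel_measurable M"
    and x0_square_integrable: "\<And>j. integrable M (\<lambda>\<omega>. (x0 \<omega> $ j)^2)"
    and w_square_integrable: "\<And>i j. integrable M (\<lambda>\<omega>. (w i \<omega> $ j)^2)"
    and w_mean_zero: "\<And>i j. i \<le> N \<Longrightarrow> expectation (\<lambda>\<omega>. w i \<omega> $ j) = 0"
    and indep: "indep_vars (\<lambda>_. borel) (\<lambda>i. case i of None \<Rightarrow> x0 | Some k \<Rightarrow> w k) (insert None (Some ` {..N}))"
    and Q_psd: "\<And>k. k \<le> N + 1 \<Longrightarrow> psd (Q k)" and R_pd: "\<And>k. k \<le> N \<Longrightarrow> pd (R k)"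
    and policy_le: "\<And>v k. policy v k \<le> k"
    and policy_causal: "\<And>v v' k. \<forall>i<k. v i = v' i \<Longrightarrow> policy v k = policy v' k"
    and policy_measurable: "\<And>k. (\<lambda>v. policy v k) \<in> measurable (Pi\<^sub>M UNIV (\<lambda>_. borel)) (count_space UNIV)"
begin

definition "X k \<omega> = state A B (riccK A B Q R N) (policy (\<lambda>i. w i \<omega>)) (x0 \<omega>) (\<lambda>i. w i \<omega>) k"
definition "U k \<omega> = input A B (riccK A B Q R N) (policy (\<lambda>i. w i \<omega>)) (x0 \<omega>) (\<lambda>i. w i \<omega>) k"
definition "cost \<omega> = path_cost A B (riccK A B Q R N) Q R \<theta> N (policy (\<lambda>i. w i \<omega>)) (x0 \<omega>) (\<lambda>i. w i \<omega>)"
definition "cross_weight k \<omega> = riccS A B Q R N (Suc k) *v (A *v X k \<omega> + B *v U k \<omega>)"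
definition "cross k \<omega> = w k \<omega> \<bullet> cross_weight k \<omega>"
definition "noise_level \<omega> = disturbance_size (x0 \<omega>) (\<lambda>i. w i \<omega>) (Suc N)"

lemma policy_measurable_compose:
  "(\<And>i. W i \<in> borel_measurable M') \<Longrightarrow> (\<lambda>\<omega>. policy (\<lambda>i. W i \<omega>) k) \<in> measurable M' (count_space UNIV)"
  by (rule measurable_policy_compose[OF policy_measurable])

lemma policy_measurable_w[measurable]:
  "(\<lambda>\<omega>. policy (\<lambda>i. w i \<omega>) k) \<in> measurable M (count_space UNIV)"
  by (rule policy_measurable_compose[OF w_measurable])

lemma X_U_measurable[measurable]: "X k \<in> borel_measurable M" "U k \<in> borel_measurable M"
  using state_input_measurable[OF x0_measurable w_measurable policy_measurable_compose policy_le,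
      where A = A and B = B and K = "riccK A B Q R N" and k = k]
  unfolding X_def U_def by auto

lemma cost_eq:
  "cost \<omega> = X (N + 1) \<omega> \<bullet> (Q (N + 1) *v X (N + 1) \<omega>) + (\<Sum>k = 0..N. - \<theta> k * real (policy (\<lambda>i. w i \<omega>) k)
     + X k \<omega> \<bullet> (Q k *v X k \<omega>) + U k \<omega> \<bullet> (R k *v U k \<omega>))"
  unfolding cost_def path_cost_def X_def U_def Let_def by simp

lemma cost_measurable[measurable]: "cost \<in> borel_measurable M"
  unfolding cost_eq[abs_def] by measurable

lemma cross_weight_measurable[measurable]: "cross_weight k \<in> borel_measurable M"
  unfolding cross_weight_def[abs_def] by measurable

lemma cross_measurable[measurable]: "cross k \<in> borel_measurable M"
  unfolding cross_def[abs_def] by measurable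

lemma noise_level_measurable[measurable]: "noise_level \<in> borel_measurable M"
  unfolding noise_level_def[abs_def] disturbance_size_def by measurable

lemma noise_level_nonneg: "0 \<le> noise_level \<omega>"
  unfolding noise_level_def by (rule disturbance_size_nonneg)

lemma noise_level_square_integrable: "integrable M (\<lambda>\<omega>. (noise_level \<omega>)^2)"
proof (rule Bochner_Integration.integrable_bound)
  let ?f = "\<lambda>\<omega>. 2 * (norm (x0 \<omega>))^2 + 2 * real (Suc N) * (\<Sum>i<Suc N. (norm (w i \<omega>))^2)"
  show "integrable M ?f"
    unfolding power2_norm_vec
    by (intro Bochner_Integration.integrable_add integrable_mult_right
        Bochner_Integration.integrable_sum x0_square_integrable w_square_integrable)
  show "AE \<omega> in M. norm ((noise_level \<omega>)^2) \<le> norm (?f \<omega>)"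
  proof (intro AE_I2)
    fix \<omega>
    have "(noise_level \<omega>)^2 \<le> ?f \<omega>"
      unfolding noise_level_def disturbance_size_def by (rule power2_sum_le)
    moreover have "0 \<le> ?f \<omega>" by (simp add: sum_nonneg)
    ultimately show "norm ((noise_level \<omega>)^2) \<le> norm (?f \<omega>)" by simp
  qed
qed measurable

lemma X_U_linear_growth:
  "\<exists>C\<ge>0. \<forall>\<omega> j. j \<le> Suc N \<longrightarrow> norm (X j \<omega>) \<le> C * noise_level \<omega> \<and> norm (U j \<omega>) \<le> C * noise_level \<omega>"
  using trajectory_linear_growth[where A = A and B = B and K = "riccK A B Q R N" and J = "Suc N"]
    policy_le unfolding X_def U_def noise_level_def by blast

lemma integrable_quadratic_growth:
  assumes [measurable]: "f \<in> borel_measurable M" and "\<And>\<omega>. \<bar>f \<omega>\<bar> \<le> \<beta> + \<gamma> * (noise_level \<omega>)^2"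
  shows "integrable M f"
proof (rule Bochner_Integration.integrable_bound)
  show "integrable M (\<lambda>\<omega>. \<beta> + \<gamma> * (noise_level \<omega>)^2)"
    by (intro Bochner_Integration.integrable_add integrable_mult_right noise_level_square_integrable) simp
  show "AE \<omega> in M. norm (f \<omega>) \<le> norm (\<beta> + \<gamma> * (noise_level \<omega>)^2)"
    using assms(2) by (intro AE_I2) (force intro: order_trans[OF _ abs_ge_self])
qed (rule assms(1))

lemma cost_integrable: "integrable M cost"
proof -
  obtain C where C: "0 \<le> C" "\<And>\<omega> j. j \<le> Suc N \<Longrightarrow> norm (X j \<omega>) \<le> C * noise_level \<omega> \<and> norm (U j \<omega>) \<le> C * noise_level \<omega>"
    using X_U_linear_growth by blast
  define \<gamma> where "\<gamma> = onorm ((*v) (Q (N + 1))) + (\<Sum>k = 0..N. onorm ((*v) (Q k)) + onorm ((*v) (R k)))"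
  define \<beta> where "\<beta> = (\<Sum>k = 0..N. \<bar>\<theta> k\<bar> * real k)"
  show ?thesis
  proof (rule integrable_quadratic_growth[where \<beta> = \<beta> and \<gamma> = "\<gamma> * C * C"])
    fix \<omega>
    let ?c = "C * noise_level \<omega>"
    have stage: "\<bar>- \<theta> k * real (policy (\<lambda>i. w i \<omega>) k) + X k \<omega> \<bullet> (Q k *v X k \<omega>) + U k \<omega> \<bullet> (R k *v U k \<omega>)\<bar>
        \<le> \<bar>\<theta> k\<bar> * real k + (onorm ((*v) (Q k)) + onorm ((*v) (R k))) * (?c * ?c)" if "k \<le> N" for k
    proof -
      have "\<bar>- \<theta> k * real (policy (\<lambda>i. w i \<omega>) k)\<bar> \<le> \<bar>\<theta> k\<bar> * real k"
        using policy_le[of "\<lambda>i. w i \<omega>" k] by (simp add: abs_mult mult_left_mono)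
      moreover have "\<bar>X k \<omega> \<bullet> (Q k *v X k \<omega>)\<bar> \<le> onorm ((*v) (Q k)) * (?c * ?c)"
        using C(2)[of k \<omega>] that by (intro abs_inner_matrix_vector_le) auto
      moreover have "\<bar>U k \<omega> \<bullet> (R k *v U k \<omega>)\<bar> \<le> onorm ((*v) (R k)) * (?c * ?c)"
        using C(2)[of k \<omega>] that by (intro abs_inner_matrix_vector_le) auto
      ultimately show ?thesis by (simp add: algebra_simps)
    qed
    have "\<bar>cost \<omega>\<bar> \<le> onorm ((*v) (Q (N + 1))) * (?c * ?c)
        + (\<Sum>k = 0..N. \<bar>\<theta> k\<bar> * real k + (onorm ((*v) (Q k)) + onorm ((*v) (R k))) * (?c * ?c))"
    proof -
      have "\<bar>X (N + 1) \<omega> \<bullet> (Q (N + 1) *v X (N + 1) \<omega>)\<bar> \<le> onorm ((*v) (Q (N + 1))) * (?c * ?c)"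
        using C(2)[of "N + 1" \<omega>] by (intro abs_inner_matrix_vector_le) auto
      moreover have "\<bar>\<Sum>k = 0..N. - \<theta> k * real (policy (\<lambda>i. w i \<omega>) k)
          + X k \<omega> \<bullet> (Q k *v X k \<omega>) + U k \<omega> \<bullet> (R k *v U k \<omega>)\<bar>
        \<le> (\<Sum>k = 0..N. \<bar>\<theta> k\<bar> * real k + (onorm ((*v) (Q k)) + onorm ((*v) (R k))) * (?c * ?c))"
        using stage by (intro order_trans[OF sum_abs sum_mono]) auto
      ultimately show ?thesis unfolding cost_eq by (rule order_trans[OF abs_triangle_ineq add_mono])
    qed
    also have "\<dots> = \<beta> + \<gamma> * (?c * ?c)"
      unfolding \<beta>_def \<gamma>_def by (simp add: sum.distrib distrib_right flip: sum_distrib_right)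
    also have "\<dots> = \<beta> + \<gamma> * C * C * (noise_level \<omega>)^2"
      by (simp add: power2_eq_square)
    finally show "\<bar>cost \<omega>\<bar> \<le> \<beta> + \<gamma> * C * C * (noise_level \<omega>)^2" .
  qed measurable
qed

lemma cross_weight_linear_growth:
  assumes "k \<le> N"
  shows "\<exists>\<kappa>\<ge>0. \<forall>\<omega>. norm (cross_weight k \<omega>) \<le> \<kappa> * noise_level \<omega>"
proof -
  obtain C where C: "0 \<le> C" "\<And>\<omega> j. j \<le> Suc N \<Longrightarrow> norm (X j \<omega>) \<le> C * noise_level \<omega> \<and> norm (U j \<omega>) \<le> C * noise_level \<omega>"
    using X_U_linear_growth by blast
  let ?S = "riccS A B Q R N (Suc k)"
  show ?thesis
  proof (intro exI[of _ "onorm ((*v) ?S) * ((onorm ((*v) A) + onorm ((*v) B)) * C)"] conjI allI)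
    show "0 \<le> onorm ((*v) ?S) * ((onorm ((*v) A) + onorm ((*v) B)) * C)"
      using C(1) by (simp add: onorm_matrix_nonneg)
    fix \<omega>
    have "norm (A *v X k \<omega> + B *v U k \<omega>)
        \<le> onorm ((*v) A) * (C * noise_level \<omega>) + onorm ((*v) B) * (C * noise_level \<omega>)"
      using C(2)[of k \<omega>] assms
      by (intro order_trans[OF norm_triangle_ineq] add_mono norm_matrix_vector_le_bound) auto
    then have "norm (cross_weight k \<omega>) \<le> onorm ((*v) ?S)
        * (onorm ((*v) A) * (C * noise_level \<omega>) + onorm ((*v) B) * (C * noise_level \<omega>))"
      unfolding cross_weight_def by (rule norm_matrix_vector_le_bound)
    then show "norm (cross_weight k \<omega>)
        \<le> onorm ((*v) ?S) * ((onorm ((*v) A) + onorm ((*v) B)) * C) * noise_level \<omega>"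
      by (simp add: algebra_simps)
  qed
qed

lemma cross_integrable:
  assumes "k \<le> N"
  shows "integrable M (cross k)"
proof -
  obtain \<kappa> where \<kappa>: "0 \<le> \<kappa>" "\<And>\<omega>. norm (cross_weight k \<omega>) \<le> \<kappa> * noise_level \<omega>"
    using cross_weight_linear_growth[OF assms] by blast
  show ?thesis
  proof (rule integrable_quadratic_growth[where \<beta> = 0 and \<gamma> = \<kappa>])
    fix \<omega>
    have "norm (w k \<omega>) \<le> noise_level \<omega>"
      unfolding noise_level_def using assms by (intro norm_le_disturbance_size) simp
    then have "\<bar>cross k \<omega>\<bar> \<le> noise_level \<omega> * (\<kappa> * noise_level \<omega>)"
      unfolding cross_def using \<kappa>(2)[of \<omega>] noise_level_nonneg[of \<omega>]
      by (intro order_trans[OF Cauchy_Schwarz_ineq2 mult_mono]) auto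
    then show "\<bar>cross k \<omega>\<bar> \<le> 0 + \<kappa> * (noise_level \<omega>)^2" by (simp add: power2_eq_square algebra_simps)
  qed measurable
qed

lemma cross_weight_component_integrable:
  assumes "k \<le> N"
  shows "integrable M (\<lambda>\<omega>. cross_weight k \<omega> $ j)"
proof -
  obtain \<kappa> where \<kappa>: "0 \<le> \<kappa>" "\<And>\<omega>. norm (cross_weight k \<omega>) \<le> \<kappa> * noise_level \<omega>"
    using cross_weight_linear_growth[OF assms] by blast
  show ?thesis
  proof (rule integrable_quadratic_growth[where \<beta> = \<kappa> and \<gamma> = \<kappa>])
    fix \<omega>
    have "noise_level \<omega> \<le> 1 + (noise_level \<omega>)^2"
      using zero_le_power2[of "noise_level \<omega> - 1"] noise_level_nonneg[of \<omega>]
      by (simp add: power2_eq_square algebra_simps)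
    then have "\<kappa> * noise_level \<omega> \<le> \<kappa> + \<kappa> * (noise_level \<omega>)^2"
      using \<kappa>(1) mult_left_mono by (fastforce simp: algebra_simps)
    then show "\<bar>cross_weight k \<omega> $ j\<bar> \<le> \<kappa> + \<kappa> * (noise_level \<omega>)^2"
      using component_le_norm_cart[of "cross_weight k \<omega>" j] \<kappa>(2)[of \<omega>] by simp
  qed measurable
qed

end


context causal_closed_loop
begin

lemma X_U_truncate:
  fixes k :: nat and \<omega> :: 'a
  defines "v \<equiv> \<lambda>i. if i < k then w i \<omega> else 0"
  shows "X k \<omega> = state A B (riccK A B Q R N) (policy v) (x0 \<omega>) v k
    \<and> U k \<omega> = input A B (riccK A B Q R N) (policy v) (x0 \<omega>) v k"
  unfolding X_def U_def
proof (rule state_input_causal)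
  show "\<forall>j\<le>k. policy (\<lambda>i. w i \<omega>) j = policy v j"
    unfolding v_def by (auto intro!: policy_causal)
qed (simp_all add: v_def policy_le)

lemma indep_w_cross_weight:
  assumes k: "k \<le> N"
  shows "indep_var borel (\<lambda>\<omega>. w k \<omega> $ j) borel (\<lambda>\<omega>. cross_weight k \<omega> $ j)"
proof -
  define Y where "Y = (\<lambda>i. case i of None \<Rightarrow> x0 | Some k \<Rightarrow> w k)"
  define I_now where "I_now = {Some k}"
  define I_past where "I_past = insert None (Some ` {..<k})"
  have "indep_var (Pi\<^sub>M I_now (\<lambda>_. borel)) (\<lambda>\<omega>. restrict (\<lambda>i. Y i \<omega>) I_now)
      (Pi\<^sub>M I_past (\<lambda>_. borel)) (\<lambda>\<omega>. restrict (\<lambda>i. Y i \<omega>) I_past)"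
    by (rule indep_var_restrict[OF indep[folded Y_def]]) (use k in \<open>auto simp: I_now_def I_past_def\<close>)
  \<comment> \<open>the cross weight at time \<open>k\<close> is a measurable function of \<open>x0\<close> and \<open>w 0, \<dots>, w (k - 1)\<close>\<close>
  moreover define past where "past f i = (if i < k then f (Some i) else (0::real^'n))"
    for f :: "nat option \<Rightarrow> real^'n" and i
  define G where "G f = (riccS A B Q R N (Suc k) *v
      (A *v state A B (riccK A B Q R N) (policy (past f)) (f None) (past f) k
     + B *v input A B (riccK A B Q R N) (policy (past f)) (f None) (past f) k)) $ j" for f
  have "(\<lambda>f. f (Some k) $ j) \<in> borel_measurable (Pi\<^sub>M I_now (\<lambda>_. borel :: (real^'n) measure))"
    unfolding I_now_def by (intro borel_measurable_vec_nth measurable_component_singleton) simp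
  moreover have "G \<in> borel_measurable (Pi\<^sub>M I_past (\<lambda>_. borel))"
  proof -
    have [measurable]: "(\<lambda>f. past f i) \<in> borel_measurable (Pi\<^sub>M I_past (\<lambda>_. borel :: (real^'n) measure))" for i
      unfolding past_def I_past_def by (cases "i < k") (simp_all add: measurable_component_singleton)
    have "(\<lambda>f. f None) \<in> borel_measurable (Pi\<^sub>M I_past (\<lambda>_. borel :: (real^'n) measure))"
      unfolding I_past_def by (simp add: measurable_component_singleton)
    from state_input_measurable[where W = "\<lambda>i f. past f i" and E = "\<lambda>k f. policy (past f) k"
        and A = A and B = B and K = "riccK A B Q R N" and k = k,
        OF this _ policy_measurable_compose policy_le]
    have [measurable]: "(\<lambda>f. state A B (riccK A B Q R N) (policy (past f)) (f None) (past f) k)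
        \<in> borel_measurable (Pi\<^sub>M I_past (\<lambda>_. borel))"
      "(\<lambda>f. input A B (riccK A B Q R N) (policy (past f)) (f None) (past f) k)
        \<in> borel_measurable (Pi\<^sub>M I_past (\<lambda>_. borel))"
      by (simp_all add: eta_expand)
    show ?thesis unfolding G_def by measurable
  qed
  ultimately have "indep_var borel ((\<lambda>f. f (Some k) $ j) \<circ> (\<lambda>\<omega>. restrict (\<lambda>i. Y i \<omega>) I_now))
      borel (G \<circ> (\<lambda>\<omega>. restrict (\<lambda>i. Y i \<omega>) I_past))"
    by (rule indep_var_compose)
  moreover have "G (restrict (\<lambda>i. Y i \<omega>) I_past) = cross_weight k \<omega> $ j" for \<omega>
  proof -
    have "past (restrict (\<lambda>i. Y i \<omega>) I_past) = (\<lambda>i. if i < k then w i \<omega> else 0)"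
      by (auto simp: past_def I_past_def Y_def)
    then show ?thesis
      using X_U_truncate[of k \<omega>] by (simp add: G_def I_past_def Y_def cross_weight_def)
  qed
  ultimately show ?thesis by (simp add: comp_def I_now_def Y_def)
qed

lemma expectation_cross_zero:
  assumes k: "k \<le> N"
  shows "expectation (cross k) = 0"
proof -
  have cross_eq: "cross k = (\<lambda>\<omega>. \<Sum>j\<in>UNIV. w k \<omega> $ j * cross_weight k \<omega> $ j)"
    by (auto simp: cross_def inner_vec_def)
  have w_int: "integrable M (\<lambda>\<omega>. w k \<omega> $ j)" for j
    by (rule square_integrable_imp_integrable) (simp_all add: w_square_integrable)
  note indep_prod = indep_w_cross_weight[OF k] w_int cross_weight_component_integrable[OF k]
  show ?thesis
    unfolding cross_eq using indep_var_lebesgue_integral[OF indep_prod] w_mean_zero[OF k]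
    by (subst Bochner_Integration.integral_sum) (auto intro: indep_var_integrable[OF indep_prod])
qed

definition "queue_cost \<omega> = (\<Sum>k = 0..N. - \<theta> k * real (policy (\<lambda>i. w i \<omega>) k)
   + estimation_error A (policy (\<lambda>i. w i \<omega>)) (\<lambda>i. w i \<omega>) k
     \<bullet> (riccGamma A B Q R N k *v estimation_error A (policy (\<lambda>i. w i \<omega>)) (\<lambda>i. w i \<omega>) k))"

definition "noise_cost \<omega> = x0 \<omega> \<bullet> (riccS A B Q R N 0 *v x0 \<omega>)
   + (\<Sum>k = 0..N. w k \<omega> \<bullet> (riccS A B Q R N (Suc k) *v w k \<omega>))"

lemma cost_decomposition:
  "cost \<omega> = noise_cost \<omega> + queue_cost \<omega> + 2 * (\<Sum>k = 0..N. cross k \<omega>)"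
proof -
  let ?e = "estimation_error A (policy (\<lambda>i. w i \<omega>)) (\<lambda>i. w i \<omega>)"
  let ?q = "\<lambda>k. - \<theta> k * real (policy (\<lambda>i. w i \<omega>) k) + ?e k \<bullet> (riccGamma A B Q R N k *v ?e k)"
  let ?n = "\<lambda>k. w k \<omega> \<bullet> (riccS A B Q R N (Suc k) *v w k \<omega>)"
  have "cost \<omega> = x0 \<omega> \<bullet> (riccS A B Q R N 0 *v x0 \<omega>) + (\<Sum>k = 0..N. ?q k + 2 * cross k \<omega> + ?n k)"
    unfolding cost_def cross_def cross_weight_def X_def U_def
    using path_cost_expansion[where eta = "policy (\<lambda>i. w i \<omega>)" and ?x0.0 = "x0 \<omega>" and w = "\<lambda>i. w i \<omega>"
        and A = A and B = B and \<theta> = \<theta>, OF Q_psd R_pd policy_le]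
    by (simp add: add.assoc)
  also have "\<dots> = noise_cost \<omega> + queue_cost \<omega> + 2 * (\<Sum>k = 0..N. cross k \<omega>)"
    unfolding noise_cost_def queue_cost_def sum.distrib sum_distrib_left by simp
  finally show ?thesis .
qed

lemma expected_cost:
  "integrable M (\<lambda>\<omega>. noise_cost \<omega> + queue_cost \<omega>)"
  "expectation cost = expectation (\<lambda>\<omega>. noise_cost \<omega> + queue_cost \<omega>)"
proof -
  have cross_int: "integrable M (\<lambda>\<omega>. \<Sum>k = 0..N. cross k \<omega>)"
    by (intro Bochner_Integration.integrable_sum cross_integrable) simp
  have cross_exp: "expectation (\<lambda>\<omega>. \<Sum>k = 0..N. cross k \<omega>) = 0"
    by (subst Bochner_Integration.integral_sum) (simp_all add: cross_integrable expectation_cross_zero)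
  have eq: "(\<lambda>\<omega>. noise_cost \<omega> + queue_cost \<omega>) = (\<lambda>\<omega>. cost \<omega> - 2 * (\<Sum>k = 0..N. cross k \<omega>))"
    by (simp add: cost_decomposition)
  show "integrable M (\<lambda>\<omega>. noise_cost \<omega> + queue_cost \<omega>)"
    unfolding eq using cost_integrable cross_int by simp
  show "expectation cost = expectation (\<lambda>\<omega>. noise_cost \<omega> + queue_cost \<omega>)"
    unfolding eq using cost_integrable cross_int cross_exp by simp
qed

end


context causal_closed_loop
begin

lemma chi_eq_expected_cost: "chi M A B Q R \<theta> N x0 w (\<lambda>k \<omega>. policy (\<lambda>t. w t \<omega>) k) = expectation cost"
  unfolding chi_def cost_def ..

end

definition truncated_noise :: "nat \<Rightarrow> (nat \<Rightarrow> 'a \<Rightarrow> real^'n) \<Rightarrow> nat \<Rightarrow> 'a \<Rightarrow> real^'n" where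
  "truncated_noise N w i \<omega> = (if i \<le> N then w i \<omega> else 0)"

lemma causal_closed_loop_of_gaussian:
  fixes M :: "'a measure" and x0 :: "'a \<Rightarrow> real^'n" and w :: "nat \<Rightarrow> 'a \<Rightarrow> real^'n"
  assumes "prob_space M"
    and x0: "gaussian_vec M x0 m0 M0" and w: "\<And>k. k \<le> N \<Longrightarrow> gaussian_vec M (w k) 0 (W k)"
    and indep: "prob_space.indep_vars M (\<lambda>_. borel)
      (\<lambda>i. case i of None \<Rightarrow> x0 | Some k \<Rightarrow> w k) (insert None (Some ` {..N}))"
    and "\<And>k. k \<le> N + 1 \<Longrightarrow> psd (Q k)" and "\<And>k. k \<le> N \<Longrightarrow> pd (R k)"
    and "\<And>v k. policy v k \<le> k" and "\<And>v v' k. \<forall>i<k. v i = v' i \<Longrightarrow> policy v k = policy v' k"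
    and "\<And>k. (\<lambda>v. policy v k) \<in> measurable (Pi\<^sub>M UNIV (\<lambda>_. borel)) (count_space UNIV)"
  shows "causal_closed_loop M Q R N x0 (truncated_noise N w) policy"
proof -
  interpret prob_space M by fact
  have w': "gaussian_vec M (truncated_noise N w i) 0 (if i \<le> N then W i else 0)" for i
    using w[of i] unfolding gaussian_vec_def truncated_noise_def[abs_def]
    by (auto simp: transpose_def vec_eq_iff prob_space)
  show ?thesis
  proof
    show "x0 \<in> borel_measurable M" using x0 unfolding gaussian_vec_def by simp
    show "truncated_noise N w i \<in> borel_measurable M" for i using w'[of i] unfolding gaussian_vec_def by simp
    show "integrable M (\<lambda>\<omega>. (x0 \<omega> $ j)^2)" for j by (rule gaussian_vec_component_moments[OF x0])
    show "integrable M (\<lambda>\<omega>. (truncated_noise N w i \<omega> $ j)^2)" for i j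
      by (rule gaussian_vec_component_moments[OF w'])
    show "expectation (\<lambda>\<omega>. truncated_noise N w i \<omega> $ j) = 0" if "i \<le> N" for i j
      using gaussian_vec_component_moments(3)[OF w'[of i]] by simp
    show "indep_vars (\<lambda>_. borel) (\<lambda>i. case i of None \<Rightarrow> x0 | Some k \<Rightarrow> truncated_noise N w k)
        (insert None (Some ` {..N}))"
      using indep by (rule indep_vars_cong[THEN iffD1, rotated 3])
        (auto simp: truncated_noise_def split: option.split)
  qed (use assms in auto)
qed

lemma chi_truncated_noise:
  assumes "\<And>v k. policy v k \<le> k" and "\<And>v v' k. \<forall>i<k. v i = v' i \<Longrightarrow> policy v k = policy v' k"
  shows "chi M A B Q R \<theta> N x0 w (\<lambda>k \<omega>. policy (\<lambda>t. w t \<omega>) k)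
    = chi M A B Q R \<theta> N x0 (truncated_noise N w) (\<lambda>k \<omega>. policy (\<lambda>t. truncated_noise N w t \<omega>) k)"
  unfolding chi_def using assms
  by (intro Bochner_Integration.integral_cong refl path_cost_causal) (auto simp: truncated_noise_def)

theorem proposition2:
  fixes M :: "'a measure"
    and A :: "real^'n^'n" and B :: "real^'m^'n"
    and Q :: "nat \<Rightarrow> real^'n^'n" and R :: "nat \<Rightarrow> real^'m^'m" and \<theta> :: "nat \<Rightarrow> real"
    and N :: nat
    and x0 :: "'a \<Rightarrow> real^'n" and w :: "nat \<Rightarrow> 'a \<Rightarrow> real^'n"
    and m0 :: "real^'n" and M0 :: "real^'n^'n" and W :: "nat \<Rightarrow> real^'n^'n"
  assumes "prob_space M"
    and "controllable A B"
    and "gaussian_vec M x0 m0 M0"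
    and "\<And>k. k \<le> N \<Longrightarrow> gaussian_vec M (w k) 0 (W k)"
    and "\<And>k. k \<le> N \<Longrightarrow> pd (W k)"
    and "prob_space.indep_vars M (\<lambda>_. borel)
           (\<lambda>i. case i of None \<Rightarrow> x0 | Some k \<Rightarrow> w k) (insert None (Some ` {..N}))"
    and "\<And>k. k \<le> N + 1 \<Longrightarrow> psd (Q k)"
    and "\<And>k. k \<le> N \<Longrightarrow> pd (R k)"
  shows "chi M A B Q R \<theta> N x0 w (\<lambda>k \<omega>. eta_plus A B Q R \<theta> N (\<lambda>t. w t \<omega>) k)
         \<le> chi M A B Q R \<theta> N x0 w (\<lambda>k \<omega>. 0)"
proof -
  interpret prob_space M by fact
  \<comment> \<open>the disturbances after the horizon never enter the cost, so they may be replaced by \<open>0\<close>\<close>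
  interpret queue: causal_closed_loop M A B Q R \<theta> N x0 "truncated_noise N w" "eta_plus A B Q R \<theta> N"
    using assms by (intro causal_closed_loop_of_gaussian eta_plus_le eta_plus_causal eta_plus_measurable_sequences)
  interpret zero_wait: causal_closed_loop M A B Q R \<theta> N x0 "truncated_noise N w" "\<lambda>_ _. 0"
    using assms by (intro causal_closed_loop_of_gaussian) auto
  have "queue.queue_cost \<omega> \<le> 0" for \<omega>
    unfolding queue.queue_cost_def by (intro sum_nonpos queue_stage_cost_nonpos)
  moreover have "zero_wait.queue_cost \<omega> = 0" for \<omega>
    unfolding zero_wait.queue_cost_def by (simp add: estimation_error_def)
  ultimately have "expectation queue.cost \<le> expectation zero_wait.cost"
    unfolding queue.expected_cost(2) zero_wait.expected_cost(2)
    by (intro integral_mono queue.expected_cost(1) zero_wait.expected_cost(1)) auto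
  moreover have "chi M A B Q R \<theta> N x0 w (\<lambda>k \<omega>. eta_plus A B Q R \<theta> N (\<lambda>t. w t \<omega>) k)
      = expectation queue.cost"
    using chi_truncated_noise[of "eta_plus A B Q R \<theta> N" M A B Q R \<theta> N x0 w, OF eta_plus_le eta_plus_causal]
    by (simp only: queue.chi_eq_expected_cost)
  moreover have "chi M A B Q R \<theta> N x0 w (\<lambda>k \<omega>. 0) = expectation zero_wait.cost"
    using chi_truncated_noise[of "\<lambda>_ _. 0" M A B Q R \<theta> N x0 w] zero_wait.chi_eq_expected_cost
    by simp
  ultimately show ?thesis by simp
qed

end
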